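(* Let $q\in\mathbb{C}^{\times}$ and let $H_q$ be the Hopf algebra defined in the context. Then $\exp_q(tD_1\otimes D_2)\in (H_q\otimes H_q)[[t]]$ is a universal deformation formula based on $H_q$.
   Context: All tensor products are over $\mathbb{C}$ and $t$ is an indeterminate. **$q$-numbers.** For $q\in\mathbb{C}^\times$ and integers $i\ge 1$, $(i)_q=1+q+\cdots+q^{i-1}$, $(0)_q=0$, $(i)_q!=(i)_q(i-1)_q\cdots(1)_q$, $(0)_q!=1$. **The $q$-exponential.** If $q=1$ or $q$ is not a root of unity, $\exp_q(y)=\sum_{i=0}^{\infty}\frac{1}{(i)_q!}y^i$ whenever this sum is defined. If $q$ is a primitive $\ell$th root of unity with $\ell\ge 2$, $\exp_q(y)=\sum_{i=0}^{\ell-1}\frac{1}{(i)_q!}y^i$. Here $y=tD_1\otimes D_2=t(D_1\otimes D_2)$. **The Hopf algebra $H_q$.** Let $H$ be the $\mathbb{C}$-algebra generated by $D_1,D_2,\sigma^{\pm1}$ subject to $D_1D_2=D_2D_1$, $q\sigma D_i=D_i\sigma$ ($i=1,2$), $\sigma\sigma^{-1}=1=\sigma^{-1}\sigma$. It is a Hopf algebra with $\Delta(D_1)=D_1\otimes\sigma+1\otimes D_1$, $\varepsilon(D_1)=0$, $S(D_1)=-D_1\sigma^{-1}$; $\Delta(D_2)=D_2\otimes 1+\sigma\otimes D_2$, $\varepsilon(D_2)=0$, $S(D_2)=-\sigma^{-1}D_2$; $\Delta(\sigma)=\sigma\otimes\sigma$, $\varepsilon(\sigma)=1$, $S(\sigma)=\sigma^{-1}$.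 If $q$ is a primitive $\ell$th root of unity with $\ell\ge2$, the ideal $I$ generated by $D_1^\ell$ and $D_2^\ell$ is a Hopf ideal. Put $H_q=H/I$ if $q$ is a primitive $\ell$th root of unity ($\ell\geq 2$), and $H_q=H$ if $q=1$ or $q$ is not a root of unity. **Universal deformation formula.** A universal deformation formula based on a bialgebra $B$ is an element $F\in(B\otimes B)[[t]]$ of the form $F=1\otimes1+tF_1+t^2F_2+\cdots$ with each $F_i\in B\otimes B$, satisfying $(\varepsilon\otimes\mathrm{id})(F)=1\otimes 1=(\mathrm{id}\otimes\varepsilon)(F)$ and $[(\Delta\otimes\mathrm{id})(F)](F\otimes1)=[(\mathrm{id}\otimes\Delta)(F)](1\otimes F)$, where all maps are extended $\mathbb{C}[[t]]$-linearly (coefficientwise in $t$). *)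

theory Defs
  imports
    Complex_Main
    "HOL-Algebra.Algebra"
    "HOL-Algebra.Algebraic_Closure_Type"
    "HOL-Library.Poly_Mapping"
begin

section \<open>Algebras over the complex numbers\<close>

text \<open>
  The locale \<open>algebra\<close> of HOL-Algebra is commutative, so the noncommutative version is spelled out
  here on the same \<open>module\<close> record.
\<close>

abbreviation complex_field :: "complex ring" where
  "complex_field \<equiv> ring_of_type_algebra"

locale complex_algebra = module complex_field A + ring A for A (structure) +
  assumes smult_mult_left:
      "\<lbrakk>x \<in> carrier A; y \<in> carrier A\<rbrakk> \<Longrightarrow> (c \<odot> x) \<otimes> y = c \<odot> (x \<otimes> y)"
    and smult_mult_right:
      "\<lbrakk>x \<in> carrier A; y \<in> carrier A\<rbrakk> \<Longrightarrow> x \<otimes> (c \<odot> y) = c \<odot> (x \<otimes> y)"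

definition algebra_hom ::
    "(complex, 'a, 'm) module_scheme \<Rightarrow> (complex, 'b, 'n) module_scheme \<Rightarrow> ('a \<Rightarrow> 'b) set" where
  "algebra_hom A B =
     {h \<in> ring_hom A B. \<forall>c. \<forall>x\<in>carrier A. h (c \<odot>\<^bsub>A\<^esub> x) = c \<odot>\<^bsub>B\<^esub> h x}"

definition scalars :: "(complex, complex) module" where
  "scalars = \<lparr>carrier = UNIV, monoid.mult = (*), one = 1, ring.zero = 0, add = (+), module.smult = (*)\<rparr>"

definition opposite :: "(complex, 'a, 'm) module_scheme \<Rightarrow> (complex, 'a, 'm) module_scheme" where
  "opposite A = A\<lparr>monoid.mult := (\<lambda>x y. y \<otimes>\<^bsub>A\<^esub> x)\<rparr>"

text \<open>
  Quotient by a two-sided ideal, or merely by a submodule when only the module structure is used.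
  A two-sided ideal of a unital algebra is stable under scalars, so \<^const>\<open>genideal\<close> is the
  algebra ideal generated by a set.
\<close>

definition quotient :: "(complex, 'a, 'm) module_scheme \<Rightarrow> 'a set \<Rightarrow> (complex, 'a set) module" where
  "quotient A I =
     \<lparr>carrier = carrier (A Quot I), monoid.mult = monoid.mult (A Quot I), one = one (A Quot I),
      ring.zero = ring.zero (A Quot I), add = add (A Quot I),
      module.smult = (\<lambda>c C. \<Union>x\<in>C. I +>\<^bsub>A\<^esub> (c \<odot>\<^bsub>A\<^esub> x))\<rparr>"

text \<open>The map induced on cosets by a map that is constant on each coset.\<close>

definition induced :: "('a \<Rightarrow> 'b) \<Rightarrow> 'a set \<Rightarrow> 'b" where
  "induced f C = the_elem (f ` C)"

definition scale :: "complex \<Rightarrow> ('k \<Rightarrow>\<^sub>0 complex) \<Rightarrow> ('k \<Rightarrow>\<^sub>0 complex)" where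
  "scale c p = Poly_Mapping.map (\<lambda>x. c * x) p"

definition linear_ext ::
    "(complex, 'v, 'm) module_scheme \<Rightarrow> ('k \<Rightarrow> 'v) \<Rightarrow> ('k \<Rightarrow>\<^sub>0 complex) \<Rightarrow> 'v" where
  "linear_ext V f p = (\<Oplus>\<^bsub>V\<^esub>k\<in>Poly_Mapping.keys p. Poly_Mapping.lookup p k \<odot>\<^bsub>V\<^esub> f k)"

section \<open>Tensor products\<close>

text \<open>
  The free vector space on a set; it is only used as a module, the multiplicative fields are
  irrelevant.
\<close>

definition free_module :: "'k set \<Rightarrow> (complex, 'k \<Rightarrow>\<^sub>0 complex) module" where
  "free_module S =
     \<lparr>carrier = {p. Poly_Mapping.keys p \<subseteq> S}, monoid.mult = undefined, one = undefined,
      ring.zero = 0, add = (+), module.smult = scale\<rparr>"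

definition bilinear_relators ::
    "(complex, 'a, 'm) module_scheme \<Rightarrow> (complex, 'b, 'n) module_scheme \<Rightarrow>
     ('a \<times> 'b \<Rightarrow>\<^sub>0 complex) set" where
  "bilinear_relators A B =
     (let e = (\<lambda>a b. Poly_Mapping.single (a, b) 1) in
      {e (a \<oplus>\<^bsub>A\<^esub> a') b - e a b - e a' b | a a' b.
         a \<in> carrier A \<and> a' \<in> carrier A \<and> b \<in> carrier B} \<union>
      {e a (b \<oplus>\<^bsub>B\<^esub> b') - e a b - e a b' | a b b'.
         a \<in> carrier A \<and> b \<in> carrier B \<and> b' \<in> carrier B} \<union>
      {e (c \<odot>\<^bsub>A\<^esub> a) b - scale c (e a b) | c a b. a \<in> carrier A \<and> b \<in> carrier B} \<union>
      {e a (c \<odot>\<^bsub>B\<^esub> b) - scale c (e a b) | c a b. a \<in> carrier A \<and> b \<in> carrier B})"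

definition tensor_null ::
    "(complex, 'a, 'm) module_scheme \<Rightarrow> (complex, 'b, 'n) module_scheme \<Rightarrow>
     ('a \<times> 'b \<Rightarrow>\<^sub>0 complex) set" where
  "tensor_null A B =
     \<Inter>{N. submodule N complex_field (free_module (carrier A \<times> carrier B)) \<and>
          bilinear_relators A B \<subseteq> N}"

definition tensor_module ::
    "(complex, 'a, 'm) module_scheme \<Rightarrow> (complex, 'b, 'n) module_scheme \<Rightarrow>
     (complex, ('a \<times> 'b \<Rightarrow>\<^sub>0 complex) set) module" where
  "tensor_module A B = quotient (free_module (carrier A \<times> carrier B)) (tensor_null A B)"

definition tensor ::
    "(complex, 'a, 'm) module_scheme \<Rightarrow> (complex, 'b, 'n) module_scheme \<Rightarrow>
     'a \<Rightarrow> 'b \<Rightarrow> ('a \<times> 'b \<Rightarrow>\<^sub>0 complex) set" where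
  "tensor A B a b =
     tensor_null A B +>\<^bsub>free_module (carrier A \<times> carrier B)\<^esub> Poly_Mapping.single (a, b) 1"

text \<open>The linear map on a tensor product induced by a bilinear map \<open>f\<close>.\<close>

definition tensor_lift ::
    "(complex, 'v, 'm) module_scheme \<Rightarrow> ('a \<Rightarrow> 'b \<Rightarrow> 'v) \<Rightarrow> ('a \<times> 'b \<Rightarrow>\<^sub>0 complex) set \<Rightarrow> 'v" where
  "tensor_lift V f = induced (linear_ext V (\<lambda>(a, b). f a b))"

text \<open>The tensor product algebra, with \<open>(a \<otimes> b)(a' \<otimes> b') = aa' \<otimes> bb'\<close>.\<close>

definition tensor_algebra ::
    "(complex, 'a, 'm) module_scheme \<Rightarrow> (complex, 'b, 'n) module_scheme \<Rightarrow>
     (complex, ('a \<times> 'b \<Rightarrow>\<^sub>0 complex) set) module" (infixr \<open>\<boxtimes>\<close> 75) where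
  "A \<boxtimes> B = (tensor_module A B)
     \<lparr>monoid.mult := (\<lambda>x y.
        tensor_lift (tensor_module A B) (\<lambda>a b.
          tensor_lift (tensor_module A B) (\<lambda>a' b'.
            tensor A B (a \<otimes>\<^bsub>A\<^esub> a') (b \<otimes>\<^bsub>B\<^esub> b')) y) x),
      one := tensor A B \<one>\<^bsub>A\<^esub> \<one>\<^bsub>B\<^esub>\<rparr>"

text \<open>\<open>f \<otimes> g\<close> for linear maps \<open>f\<close> into \<open>C\<close> and \<open>g\<close> into \<open>D\<close>.\<close>

definition tensor_map ::
    "(complex, 'c, 'm) module_scheme \<Rightarrow> (complex, 'd, 'n) module_scheme \<Rightarrow>
     ('a \<Rightarrow> 'c) \<Rightarrow> ('b \<Rightarrow> 'd) \<Rightarrow> ('a \<times> 'b \<Rightarrow>\<^sub>0 complex) set \<Rightarrow> ('c \<times> 'd \<Rightarrow>\<^sub>0 complex) set" where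
  "tensor_map C D f g = tensor_lift (C \<boxtimes> D) (\<lambda>a b. tensor C D (f a) (g b))"

text \<open>The canonical identification of \<open>(A \<otimes> B) \<otimes> C\<close> with \<open>A \<otimes> (B \<otimes> C)\<close>.\<close>

definition associator ::
    "(complex, 'a, 'l) module_scheme \<Rightarrow> (complex, 'b, 'm) module_scheme \<Rightarrow>
     (complex, 'c, 'n) module_scheme \<Rightarrow>
     (('a \<times> 'b \<Rightarrow>\<^sub>0 complex) set \<times> 'c \<Rightarrow>\<^sub>0 complex) set \<Rightarrow>
     ('a \<times> ('b \<times> 'c \<Rightarrow>\<^sub>0 complex) set \<Rightarrow>\<^sub>0 complex) set" where
  "associator A B C =
     tensor_lift (A \<boxtimes> B \<boxtimes> C) (\<lambda>x c.
       tensor_lift (A \<boxtimes> B \<boxtimes> C) (\<lambda>a b. tensor A (B \<boxtimes> C) a (tensor B C b c)) x)"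

section \<open>Bialgebras and Hopf algebras\<close>

record 'a bialg = "(complex, 'a) module" +
  comult :: "'a \<Rightarrow> ('a \<times> 'a \<Rightarrow>\<^sub>0 complex) set"
  counit :: "'a \<Rightarrow> complex"

record 'a hopf = "'a bialg" +
  antipode :: "'a \<Rightarrow> 'a"

locale bialgebra = complex_algebra B for B :: "('a, 'm) bialg_scheme" (structure) +
  assumes comult_hom: "comult B \<in> algebra_hom B (B \<boxtimes> B)"
    and counit_hom: "counit B \<in> algebra_hom B scalars"
    and coassoc: "x \<in> carrier B \<Longrightarrow>
      associator B B B (tensor_map (B \<boxtimes> B) B (comult B) id (comult B x)) =
      tensor_map B (B \<boxtimes> B) id (comult B) (comult B x)"
    and counit_left: "x \<in> carrier B \<Longrightarrow>
      tensor_map scalars B (counit B) id (comult B x) = tensor scalars B 1 x"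
    and counit_right: "x \<in> carrier B \<Longrightarrow>
      tensor_map B scalars id (counit B) (comult B x) = tensor B scalars x 1"

section \<open>Formal power series and universal deformation formulas\<close>

text \<open>\<open>A[[t]]\<close>, a series being the sequence of its coefficients.\<close>

definition power_series :: "(complex, 'a, 'm) module_scheme \<Rightarrow> (complex, nat \<Rightarrow> 'a) module" where
  "power_series A =
     \<lparr>carrier = {F. \<forall>n. F n \<in> carrier A},
      monoid.mult = (\<lambda>F G n. \<Oplus>\<^bsub>A\<^esub>i\<in>{..n}. F i \<otimes>\<^bsub>A\<^esub> G (n - i)),
      one = (\<lambda>n. if n = 0 then \<one>\<^bsub>A\<^esub> else \<zero>\<^bsub>A\<^esub>),
      ring.zero = (\<lambda>n. \<zero>\<^bsub>A\<^esub>),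
      add = (\<lambda>F G n. F n \<oplus>\<^bsub>A\<^esub> G n),
      module.smult = (\<lambda>c F n. c \<odot>\<^bsub>A\<^esub> F n)\<rparr>"

text \<open>The series \<open>t a\<close>.\<close>

definition t_times :: "(complex, 'a, 'm) module_scheme \<Rightarrow> 'a \<Rightarrow> nat \<Rightarrow> 'a" where
  "t_times A a = (\<lambda>n. if n = 1 then a else \<zero>\<^bsub>A\<^esub>)"

text \<open>
  The \<open>\<complex>[[t]]\<close>-linear extension of a map \<open>f\<close> sends a series \<open>F\<close> to \<open>f \<circ> F\<close>.  The counit conditions
  live in \<open>(\<complex> \<otimes> B)[[t]]\<close> and \<open>(B \<otimes> \<complex>)[[t]]\<close>, whose units are \<open>1 \<otimes> 1\<close>.
\<close>

definition universal_deformation_formula ::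
    "('a, 'm) bialg_scheme \<Rightarrow> (nat \<Rightarrow> ('a \<times> 'a \<Rightarrow>\<^sub>0 complex) set) \<Rightarrow> bool" where
  "universal_deformation_formula B F \<longleftrightarrow>
     bialgebra B \<and>
     F \<in> carrier (power_series (B \<boxtimes> B)) \<and>
     F 0 = tensor B B \<one>\<^bsub>B\<^esub> \<one>\<^bsub>B\<^esub> \<and>
     tensor_map scalars B (counit B) id \<circ> F = \<one>\<^bsub>power_series (scalars \<boxtimes> B)\<^esub> \<and>
     tensor_map B scalars id (counit B) \<circ> F = \<one>\<^bsub>power_series (B \<boxtimes> scalars)\<^esub> \<and>
     associator B B B \<circ>
       ((tensor_map (B \<boxtimes> B) B (comult B) id \<circ> F) \<otimes>\<^bsub>power_series ((B \<boxtimes> B) \<boxtimes> B)\<^esub>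
        ((\<lambda>x. tensor (B \<boxtimes> B) B x \<one>\<^bsub>B\<^esub>) \<circ> F)) =
     (tensor_map B (B \<boxtimes> B) id (comult B) \<circ> F) \<otimes>\<^bsub>power_series (B \<boxtimes> B \<boxtimes> B)\<^esub>
       ((\<lambda>x. tensor B (B \<boxtimes> B) \<one>\<^bsub>B\<^esub> x) \<circ> F)"

section \<open>The q-exponential\<close>

definition q_number :: "complex \<Rightarrow> nat \<Rightarrow> complex" where
  "q_number q i = (\<Sum>k<i. q ^ k)"

definition q_fact :: "complex \<Rightarrow> nat \<Rightarrow> complex" where
  "q_fact q i = (\<Prod>k=1..i. q_number q k)"

definition root_of_unity :: "complex \<Rightarrow> bool" where
  "root_of_unity q \<longleftrightarrow> (\<exists>n>0. q ^ n = 1)"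

definition primitive_root_of_unity :: "nat \<Rightarrow> complex \<Rightarrow> bool" where
  "primitive_root_of_unity l q \<longleftrightarrow> l > 0 \<and> q ^ l = 1 \<and> (\<forall>k. 0 < k \<and> k < l \<longrightarrow> q ^ k \<noteq> 1)"

text \<open>
  The index set is all of \<open>\<nat>\<close> if \<open>q = 1\<close> or \<open>q\<close> is not a root of unity, since then \<open>q\<close> is a primitive
  \<open>l\<close>-th root of unity for no \<open>l \<ge> 2\<close>, and it is \<open>{0..l-1}\<close> if \<open>q\<close> is a primitive \<open>l\<close>-th root of unity
  with \<open>l \<ge> 2\<close>.  The sum is taken coefficientwise in \<open>t\<close> and is meaningful when only finitely many
  of the powers \<open>Y\<^sup>i\<close> contribute to each coefficient, e.g. when \<open>Y\<close> has no constant term.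
\<close>

definition q_exp ::
    "(complex, 'a, 'm) module_scheme \<Rightarrow> complex \<Rightarrow> (nat \<Rightarrow> 'a) \<Rightarrow> (nat \<Rightarrow> 'a)" where
  "q_exp A q Y = (\<lambda>n.
     \<Oplus>\<^bsub>A\<^esub>i\<in>{i. (\<forall>l\<ge>2. primitive_root_of_unity l q \<longrightarrow> i < l) \<and>
                (Y [^]\<^bsub>power_series A\<^esub> i) n \<noteq> \<zero>\<^bsub>A\<^esub>}.
       (1 / q_fact q i) \<odot>\<^bsub>A\<^esub> (Y [^]\<^bsub>power_series A\<^esub> i) n)"

section \<open>Free algebras\<close>

text \<open>
  Words form a monoid under concatenation.  It is written additively so that
  \<open>'g word \<Rightarrow>\<^sub>0 complex\<close>, with the library's multiplication, is the free algebra on \<open>'g\<close>.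
\<close>

datatype 'g word = Word (letters: "'g list")

instantiation word :: (type) monoid_add
begin

definition zero_word :: "'a word" where
  "zero_word = Word []"

definition plus_word :: "'a word \<Rightarrow> 'a word \<Rightarrow> 'a word" where
  "plus_word u v = Word (letters u @ letters v)"

instance
  by standard (simp_all add: zero_word_def plus_word_def)

end

definition free_algebra :: "(complex, 'g word \<Rightarrow>\<^sub>0 complex) module" where
  "free_algebra =
     \<lparr>carrier = UNIV, monoid.mult = (*), one = 1, ring.zero = 0, add = (+), module.smult = scale\<rparr>"

definition letter :: "'g \<Rightarrow> ('g word \<Rightarrow>\<^sub>0 complex)" where
  "letter g = Poly_Mapping.single (Word [g]) 1"

text \<open>The algebra homomorphism from the free algebra that sends \<open>letter g\<close> to \<open>f g\<close>.\<close>

definition free_eval ::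
    "(complex, 'a, 'm) module_scheme \<Rightarrow> ('g \<Rightarrow> 'a) \<Rightarrow> ('g word \<Rightarrow>\<^sub>0 complex) \<Rightarrow> 'a" where
  "free_eval A f =
     linear_ext A (\<lambda>w. foldr (\<lambda>g x. f g \<otimes>\<^bsub>A\<^esub> x) (letters w) \<one>\<^bsub>A\<^esub>)"

section \<open>The Hopf algebras \<open>H\<close> and \<open>H / I\<close>\<close>

datatype gen = D1 | D2 | Sigma | Sigma_inv

definition H_relators :: "complex \<Rightarrow> (gen word \<Rightarrow>\<^sub>0 complex) set" where
  "H_relators q =
     {letter D1 * letter D2 - letter D2 * letter D1,
      scale q (letter Sigma * letter D1) - letter D1 * letter Sigma,
      scale q (letter Sigma * letter D2) - letter D2 * letter Sigma,
      letter Sigma * letter Sigma_inv - 1,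
      letter Sigma_inv * letter Sigma - 1}"

definition H_ideal :: "complex \<Rightarrow> (gen word \<Rightarrow>\<^sub>0 complex) set" where
  "H_ideal q = Idl\<^bsub>free_algebra\<^esub> (H_relators q)"

definition H_algebra :: "complex \<Rightarrow> (complex, (gen word \<Rightarrow>\<^sub>0 complex) set) module" where
  "H_algebra q = quotient free_algebra (H_ideal q)"

definition H_gen :: "complex \<Rightarrow> gen \<Rightarrow> (gen word \<Rightarrow>\<^sub>0 complex) set" where
  "H_gen q g = H_ideal q +>\<^bsub>free_algebra\<^esub> letter g"

definition H_comult_gen ::
    "complex \<Rightarrow> gen \<Rightarrow> ((gen word \<Rightarrow>\<^sub>0 complex) set \<times> (gen word \<Rightarrow>\<^sub>0 complex) set \<Rightarrow>\<^sub>0 complex) set" where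
  "H_comult_gen q g =
     (let A = H_algebra q; x = H_gen q; ten = tensor A A in
      case g of
        D1 \<Rightarrow> ten (x D1) (x Sigma) \<oplus>\<^bsub>A \<boxtimes> A\<^esub> ten \<one>\<^bsub>A\<^esub> (x D1)
      | D2 \<Rightarrow> ten (x D2) \<one>\<^bsub>A\<^esub> \<oplus>\<^bsub>A \<boxtimes> A\<^esub> ten (x Sigma) (x D2)
      | Sigma \<Rightarrow> ten (x Sigma) (x Sigma)
      | Sigma_inv \<Rightarrow> ten (x Sigma_inv) (x Sigma_inv))"

definition H_counit_gen :: "gen \<Rightarrow> complex" where
  "H_counit_gen g = (case g of D1 \<Rightarrow> 0 | D2 \<Rightarrow> 0 | Sigma \<Rightarrow> 1 | Sigma_inv \<Rightarrow> 1)"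

definition H_antipode_gen :: "complex \<Rightarrow> gen \<Rightarrow> (gen word \<Rightarrow>\<^sub>0 complex) set" where
  "H_antipode_gen q g =
     (let A = H_algebra q; x = H_gen q in
      case g of
        D1 \<Rightarrow> \<ominus>\<^bsub>A\<^esub> (x D1 \<otimes>\<^bsub>A\<^esub> x Sigma_inv)
      | D2 \<Rightarrow> \<ominus>\<^bsub>A\<^esub> (x Sigma_inv \<otimes>\<^bsub>A\<^esub> x D2)
      | Sigma \<Rightarrow> x Sigma_inv
      | Sigma_inv \<Rightarrow> x Sigma)"

text \<open>
  The comultiplication and the counit are the algebra homomorphisms, and the antipode is the
  algebra antihomomorphism, with the prescribed values on the generators.
\<close>

definition H :: "complex \<Rightarrow> (gen word \<Rightarrow>\<^sub>0 complex) set hopf" where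
  "H q =
     (let A = H_algebra q in
      \<lparr>carrier = carrier A, monoid.mult = monoid.mult A, one = one A,
       ring.zero = ring.zero A, add = add A, module.smult = module.smult A,
       comult = induced (free_eval (A \<boxtimes> A) (H_comult_gen q)),
       counit = induced (free_eval scalars H_counit_gen),
       antipode = induced (free_eval (opposite A) (H_antipode_gen q))\<rparr>)"

text \<open>The quotient of a Hopf algebra by a Hopf ideal, with the induced structure maps.\<close>

definition hopf_quotient :: "('a, 'm) hopf_scheme \<Rightarrow> 'a set \<Rightarrow> 'a set hopf" where
  "hopf_quotient B I =
     (let Q = quotient B I; \<pi> = (\<lambda>x. I +>\<^bsub>B\<^esub> x) in
      \<lparr>carrier = carrier Q, monoid.mult = monoid.mult Q, one = one Q,
       ring.zero = ring.zero Q, add = add Q, module.smult = module.smult Q,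
       comult = induced (\<lambda>x. tensor_map Q Q \<pi> \<pi> (comult B x)),
       counit = induced (counit B),
       antipode = induced (\<lambda>x. \<pi> (antipode B x))\<rparr>)"

text \<open>
  The Hopf algebra \<open>H\<^sub>q\<close> is \<open>H q\<close> if \<open>q = 1\<close> or \<open>q\<close> is not a root of unity, and \<open>H_mod q l\<close> if \<open>q\<close> is a
  primitive \<open>l\<close>-th root of unity with \<open>l \<ge> 2\<close>.  The two have different types, so statements
  about \<open>H\<^sub>q\<close> are made by cases.
\<close>

definition D_ideal :: "complex \<Rightarrow> nat \<Rightarrow> (gen word \<Rightarrow>\<^sub>0 complex) set set" where
  "D_ideal q l = Idl\<^bsub>H q\<^esub> {H_gen q D1 [^]\<^bsub>H q\<^esub> l, H_gen q D2 [^]\<^bsub>H q\<^esub> l}"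

definition H_mod :: "complex \<Rightarrow> nat \<Rightarrow> (gen word \<Rightarrow>\<^sub>0 complex) set set hopf" where
  "H_mod q l = hopf_quotient (H q) (D_ideal q l)"

definition H_mod_gen :: "complex \<Rightarrow> nat \<Rightarrow> gen \<Rightarrow> (gen word \<Rightarrow>\<^sub>0 complex) set set" where
  "H_mod_gen q l g = D_ideal q l +>\<^bsub>H q\<^esub> H_gen q g"

end

theory Submission
  imports Defs
begin

text \<open>
  Write \<open>e\<^sub>n(x) = x\<^sup>n / (n)\<^sub>q!\<close>, so that \<open>exp\<^sub>q(t x) = \<Sum> t\<^sup>n e\<^sub>n(x)\<close>.  If \<open>yx = q xy\<close>, the \<open>q\<close>-binomial
  theorem gives \<open>exp\<^sub>q(t(x + y)) = exp\<^sub>q(t x) exp\<^sub>q(t y)\<close>, also at a root of unity of order \<open>l\<close>,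
  provided that \<open>x\<^sup>i y\<^sup>j = 0\<close> for \<open>i + j \<ge> l\<close>.  In \<open>H\<^sub>q \<otimes> H\<^sub>q \<otimes> H\<^sub>q\<close> put \<open>\<xi> = D\<^sub>1 \<otimes> \<sigma> \<otimes> D\<^sub>2\<close>,
  \<open>\<eta> = 1 \<otimes> D\<^sub>1 \<otimes> D\<^sub>2\<close> and \<open>\<zeta> = D\<^sub>1 \<otimes> D\<^sub>2 \<otimes> 1\<close>.  The comultiplication turns the two sides of the
  twisting equation into \<open>exp\<^sub>q(t(\<xi> + \<eta>)) exp\<^sub>q(t \<zeta>)\<close> and \<open>exp\<^sub>q(t(\<xi> + \<zeta>)) exp\<^sub>q(t \<eta>)\<close>.  Since
  \<open>\<eta>\<xi> = q \<xi>\<eta>\<close>, \<open>\<zeta>\<xi> = q \<xi>\<zeta>\<close> and \<open>\<eta>\<zeta> = \<zeta>\<eta>\<close>, both are equal to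
  \<open>exp\<^sub>q(t \<xi>) exp\<^sub>q(t \<eta>) exp\<^sub>q(t \<zeta>)\<close>.
\<close>

section \<open>Linear maps and algebra homomorphisms\<close>

text \<open>Truncation at a root of unity is the obstacle. For i, j < l with i + j \<ge> l the
  product exp_q(t x) exp_q(t y) contains a term in x^i y^j that exp_q(t(x + y)) lacks, so this
  monomial has to vanish. It does for the two pairs that are merged: \<xi>^i \<eta>^j has D_2^(i+j)
  in its third leg, and \<xi>^i \<zeta>^j has D_1^(i+j) in its first. In \<eta>^i \<zeta>^j, with
  legs D_1^j, D_1^i D_2^j and D_2^i, no generator reaches the power i + j in one leg; this pair is
  only commuted, never merged.

  A deformation formula presupposes a bialgebra, so the structure maps have to be shown well defined
  and coassociative too. That the comultiplication descends to H/I rests on the same q-binomial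
  theorem: for n = l all inner coefficients vanish.

  H and H/I have different types, and tensor products are concrete sets of cosets. The computation
  therefore takes place in an abstract bialgebra with four generators, and every map is handled
  through a universal property and its values on generators or pure tensors.\<close>

lemma complex_field_simps [simp]:
  "carrier complex_field = UNIV" "\<one>\<^bsub>complex_field\<^esub> = 1" "\<zero>\<^bsub>complex_field\<^esub> = 0"
  "x \<otimes>\<^bsub>complex_field\<^esub> y = x * y" "x \<oplus>\<^bsub>complex_field\<^esub> y = x + y"
  by (simp_all add: ring_of_type_algebra_def)

lemma cring_complex_field [simp, intro]: "cring complex_field"
  by (rule cring_from_type_algebra)

text \<open>The additive inverse of x is (-1) x, so the single premise 0 x = 0 replaces the
  existence of inverses.\<close>

lemma complex_moduleI:
  fixes V (structure)
  assumes "\<And>x y. \<lbrakk>x \<in> carrier V; y \<in> carrier V\<rbrakk> \<Longrightarrow> x \<oplus> y \<in> carrier V"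
    and "\<zero> \<in> carrier V"
    and "\<And>x y z. \<lbrakk>x \<in> carrier V; y \<in> carrier V; z \<in> carrier V\<rbrakk> \<Longrightarrow> (x \<oplus> y) \<oplus> z = x \<oplus> (y \<oplus> z)"
    and "\<And>x y. \<lbrakk>x \<in> carrier V; y \<in> carrier V\<rbrakk> \<Longrightarrow> x \<oplus> y = y \<oplus> x"
    and "\<And>x. x \<in> carrier V \<Longrightarrow> \<zero> \<oplus> x = x"
    and smult_zero: "\<And>x. x \<in> carrier V \<Longrightarrow> 0 \<odot> x = \<zero>"
    and "\<And>c x. x \<in> carrier V \<Longrightarrow> c \<odot> x \<in> carrier V"
    and distr: "\<And>c d x. x \<in> carrier V \<Longrightarrow> (c + d) \<odot> x = c \<odot> x \<oplus> d \<odot> x"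
    and "\<And>c x y. \<lbrakk>x \<in> carrier V; y \<in> carrier V\<rbrakk> \<Longrightarrow> c \<odot> (x \<oplus> y) = c \<odot> x \<oplus> c \<odot> y"
    and "\<And>c d x. x \<in> carrier V \<Longrightarrow> (c * d) \<odot> x = c \<odot> (d \<odot> x)"
    and one: "\<And>x. x \<in> carrier V \<Longrightarrow> 1 \<odot> x = x"
  shows "module complex_field V"
proof (rule moduleI)
  show "abelian_group V"
  proof (rule abelian_groupI)
    fix x assume x: "x \<in> carrier V"
    have "(- 1) \<odot> x \<oplus> x = \<zero>"
      using distr[OF x, of "-1" 1] x by (simp add: one smult_zero)
    then show "\<exists>y\<in>carrier V. y \<oplus> x = \<zero>"
      using assms(7) x by blast
  qed (use assms in auto)
qed (use assms in auto)

lemma complex_algebraI: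
  fixes A (structure)
  assumes "module complex_field A"
    and "\<one> \<in> carrier A"
    and "\<And>x y. \<lbrakk>x \<in> carrier A; y \<in> carrier A\<rbrakk> \<Longrightarrow> x \<otimes> y \<in> carrier A"
    and "\<And>x y z. \<lbrakk>x \<in> carrier A; y \<in> carrier A; z \<in> carrier A\<rbrakk> \<Longrightarrow> (x \<otimes> y) \<otimes> z = x \<otimes> (y \<otimes> z)"
    and "\<And>x. x \<in> carrier A \<Longrightarrow> \<one> \<otimes> x = x"
    and "\<And>x. x \<in> carrier A \<Longrightarrow> x \<otimes> \<one> = x"
    and "\<And>x y z. \<lbrakk>x \<in> carrier A; y \<in> carrier A; z \<in> carrier A\<rbrakk> \<Longrightarrow> (x \<oplus> y) \<otimes> z = x \<otimes> z \<oplus> y \<otimes> z"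
    and "\<And>x y z. \<lbrakk>x \<in> carrier A; y \<in> carrier A; z \<in> carrier A\<rbrakk> \<Longrightarrow> z \<otimes> (x \<oplus> y) = z \<otimes> x \<oplus> z \<otimes> y"
    and "\<And>c x y. \<lbrakk>x \<in> carrier A; y \<in> carrier A\<rbrakk> \<Longrightarrow> (c \<odot> x) \<otimes> y = c \<odot> (x \<otimes> y)"
    and "\<And>c x y. \<lbrakk>x \<in> carrier A; y \<in> carrier A\<rbrakk> \<Longrightarrow> x \<otimes> (c \<odot> y) = c \<odot> (x \<otimes> y)"
  shows "complex_algebra A"
proof -
  interpret module complex_field A by fact
  have "ring A"
    by (rule ringI) (use assms in \<open>auto intro: monoidI simp: M.abelian_group_axioms\<close>)
  with assms show ?thesis
    by (intro complex_algebra.intro complex_algebra_axioms.intro) auto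
qed

text \<open>Several records here share their linear structure but differ in multiplication or in
  further fields, such as \<open>tensor_module A B\<close> and \<open>A \<boxtimes> B\<close>. The
  module axioms pass from one to the other.\<close>

lemma module_cong:
  fixes V :: "(complex, 'a, 'm) module_scheme" and W :: "(complex, 'a, 'n) module_scheme"
  assumes "module complex_field V" "carrier W = carrier V" "add W = add V"
    "ring.zero W = ring.zero V" "module.smult W = module.smult V"
  shows "module complex_field W"
proof -
  interpret module complex_field V by fact
  show ?thesis
    by (rule complex_moduleI)
      (simp_all add: assms(2-5) M.a_ac smult_r_distr
        smult_l_distr[of _ _ x for x, simplified] smult_assoc1[of _ _ x for x, simplified]
        smult_l_null[simplified] smult_one[simplified])
qed

lemma complex_algebra_cong:
  fixes A :: "(complex, 'a, 'm) module_scheme" and B :: "(complex, 'a, 'n) module_scheme"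
  assumes "complex_algebra A" "carrier B = carrier A" "add B = add A"
    "ring.zero B = ring.zero A" "module.smult B = module.smult A"
    "monoid.mult B = monoid.mult A" "one B = one A"
  shows "complex_algebra B"
proof -
  interpret complex_algebra A by fact
  show ?thesis
    by (rule complex_algebraI[OF module_cong[OF module_axioms assms(2-5)]])
      (simp_all add: assms(2-) m_assoc l_distr r_distr smult_mult_left smult_mult_right)
qed

section \<open>Linear and bilinear maps\<close>

definition linear_map ::
    "(complex, 'a, 'm) module_scheme \<Rightarrow> (complex, 'b, 'n) module_scheme \<Rightarrow> ('a \<Rightarrow> 'b) \<Rightarrow> bool" where
  "linear_map V W h \<longleftrightarrow>
     (\<forall>x\<in>carrier V. h x \<in> carrier W) \<and>
     (\<forall>x\<in>carrier V. \<forall>y\<in>carrier V. h (x \<oplus>\<^bsub>V\<^esub> y) = h x \<oplus>\<^bsub>W\<^esub> h y) \<and>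
     (\<forall>c. \<forall>x\<in>carrier V. h (c \<odot>\<^bsub>V\<^esub> x) = c \<odot>\<^bsub>W\<^esub> h x)"

lemma linear_mapI:
  assumes "\<And>x. x \<in> carrier V \<Longrightarrow> h x \<in> carrier W"
    and "\<And>x y. \<lbrakk>x \<in> carrier V; y \<in> carrier V\<rbrakk> \<Longrightarrow> h (x \<oplus>\<^bsub>V\<^esub> y) = h x \<oplus>\<^bsub>W\<^esub> h y"
    and "\<And>c x. x \<in> carrier V \<Longrightarrow> h (c \<odot>\<^bsub>V\<^esub> x) = c \<odot>\<^bsub>W\<^esub> h x"
  shows "linear_map V W h"
  using assms unfolding linear_map_def by blast

lemma linear_map_closed: "\<lbrakk>linear_map V W h; x \<in> carrier V\<rbrakk> \<Longrightarrow> h x \<in> carrier W"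
  and linear_map_add:
    "\<lbrakk>linear_map V W h; x \<in> carrier V; y \<in> carrier V\<rbrakk> \<Longrightarrow> h (x \<oplus>\<^bsub>V\<^esub> y) = h x \<oplus>\<^bsub>W\<^esub> h y"
  and linear_map_smult: "\<lbrakk>linear_map V W h; x \<in> carrier V\<rbrakk> \<Longrightarrow> h (c \<odot>\<^bsub>V\<^esub> x) = c \<odot>\<^bsub>W\<^esub> h x"
  by (auto simp: linear_map_def)

lemmas linear_map_simps = linear_map_closed linear_map_add linear_map_smult

lemma linear_map_zero:
  assumes "linear_map V W h" "module complex_field V" "module complex_field W"
  shows "h \<zero>\<^bsub>V\<^esub> = \<zero>\<^bsub>W\<^esub>"
proof -
  interpret V: module complex_field V by fact
  interpret W: module complex_field W by fact
  have "h (0 \<odot>\<^bsub>V\<^esub> \<zero>\<^bsub>V\<^esub>) = 0 \<odot>\<^bsub>W\<^esub> h \<zero>\<^bsub>V\<^esub>"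
    using linear_map_smult[OF assms(1) V.zero_closed] .
  then show ?thesis
    using assms(1) V.smult_l_null[simplified] W.smult_l_null[simplified]
    by (simp add: linear_map_closed)
qed

lemma linear_map_comp:
  "\<lbrakk>linear_map U V g; linear_map V W h\<rbrakk> \<Longrightarrow> linear_map U W (\<lambda>x. h (g x))"
  by (simp add: linear_map_def)

lemma linear_map_id: "linear_map V V (\<lambda>x. x)" "linear_map V V id"
  by (simp_all add: linear_map_def)

lemma linear_map_finsum:
  assumes "linear_map V W h" "module complex_field V" "module complex_field W"
    "f \<in> I \<rightarrow> carrier V"
  shows "h (finsum V f I) = finsum W (\<lambda>i. h (f i)) I"
proof -
  interpret V: module complex_field V by fact
  interpret W: module complex_field W by fact
  show ?thesis
    using assms(4)
    by (induction I rule: infinite_finite_induct)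
      (simp_all add: linear_map_zero[OF assms(1-3)] linear_map_simps[OF assms(1)] Pi_def)
qed

definition bilinear_map ::
    "(complex, 'a, 'l) module_scheme \<Rightarrow> (complex, 'b, 'm) module_scheme \<Rightarrow>
     (complex, 'c, 'n) module_scheme \<Rightarrow> ('a \<Rightarrow> 'b \<Rightarrow> 'c) \<Rightarrow> bool" where
  "bilinear_map U V W f \<longleftrightarrow>
     (\<forall>u\<in>carrier U. linear_map V W (f u)) \<and> (\<forall>v\<in>carrier V. linear_map U W (\<lambda>u. f u v))"

lemma bilinear_mapI:
  assumes "\<And>u. u \<in> carrier U \<Longrightarrow> linear_map V W (f u)"
    and "\<And>v. v \<in> carrier V \<Longrightarrow> linear_map U W (\<lambda>u. f u v)"
  shows "bilinear_map U V W f"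
  using assms by (simp add: bilinear_map_def)

lemma bilinear_mapD:
  assumes "bilinear_map U V W f"
  shows "u \<in> carrier U \<Longrightarrow> linear_map V W (f u)"
    and "v \<in> carrier V \<Longrightarrow> linear_map U W (\<lambda>u. f u v)"
  using assms by (simp_all add: bilinear_map_def)

section \<open>Algebra homomorphisms and generating sets\<close>

lemma algebra_homI:
  assumes "linear_map A B h"
    and "\<And>x y. \<lbrakk>x \<in> carrier A; y \<in> carrier A\<rbrakk> \<Longrightarrow> h (x \<otimes>\<^bsub>A\<^esub> y) = h x \<otimes>\<^bsub>B\<^esub> h y"
    and "h \<one>\<^bsub>A\<^esub> = \<one>\<^bsub>B\<^esub>"
  shows "h \<in> algebra_hom A B"
  using assms by (simp add: algebra_hom_def ring_hom_def linear_map_def)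

lemma algebra_hom_linear: "h \<in> algebra_hom A B \<Longrightarrow> linear_map A B h"
  by (simp add: algebra_hom_def ring_hom_def linear_map_def Pi_def)

lemma algebra_hom_mult:
  "\<lbrakk>h \<in> algebra_hom A B; x \<in> carrier A; y \<in> carrier A\<rbrakk> \<Longrightarrow> h (x \<otimes>\<^bsub>A\<^esub> y) = h x \<otimes>\<^bsub>B\<^esub> h y"
  and algebra_hom_one: "h \<in> algebra_hom A B \<Longrightarrow> h \<one>\<^bsub>A\<^esub> = \<one>\<^bsub>B\<^esub>"
  by (auto simp: algebra_hom_def ring_hom_def)

lemmas algebra_hom_simps =
  algebra_hom_mult algebra_hom_one linear_map_simps[OF algebra_hom_linear]

lemma algebra_hom_comp:
  assumes "g \<in> algebra_hom A B" "h \<in> algebra_hom B C"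
  shows "(\<lambda>x. h (g x)) \<in> algebra_hom A C"
  by (rule algebra_homI[OF linear_map_comp[OF assms[THEN algebra_hom_linear]]])
    (simp_all add: algebra_hom_simps[OF assms(1)] algebra_hom_simps[OF assms(2)])

lemma algebra_hom_id: "(\<lambda>x. x) \<in> algebra_hom A A" "id \<in> algebra_hom A A"
  by (simp_all add: algebra_homI linear_map_id)

lemma algebra_hom_pow:
  assumes "h \<in> algebra_hom A B" "ring A" "ring B" "x \<in> carrier A"
  shows "h (x [^]\<^bsub>A\<^esub> (n::nat)) = h x [^]\<^bsub>B\<^esub> n"
proof -
  interpret A: ring A by fact
  interpret B: ring B by fact
  show ?thesis
    by (induction n) (simp_all add: algebra_hom_simps[OF assms(1)] assms(4))
qed

text \<open>Quantifying over all closed sets K makes this an induction principle. Closure under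
  scalars, including 0, takes care of zero and negatives.\<close>

definition generates :: "(complex, 'a, 'm) module_scheme \<Rightarrow> 'a set \<Rightarrow> bool" where
  "generates A S \<longleftrightarrow>
     (\<forall>K. S \<subseteq> K \<and> \<one>\<^bsub>A\<^esub> \<in> K \<and> (\<forall>x\<in>K. \<forall>y\<in>K. x \<oplus>\<^bsub>A\<^esub> y \<in> K) \<and> (\<forall>c. \<forall>x\<in>K. c \<odot>\<^bsub>A\<^esub> x \<in> K) \<and>
          (\<forall>x\<in>K. \<forall>y\<in>K. x \<otimes>\<^bsub>A\<^esub> y \<in> K) \<longrightarrow> carrier A \<subseteq> K)"

lemma generates_cong:
  fixes A :: "(complex, 'a, 'm) module_scheme" and B :: "(complex, 'a, 'n) module_scheme"
  assumes "carrier B = carrier A" "add B = add A" "module.smult B = module.smult A"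
    "monoid.mult B = monoid.mult A" "one B = one A"
  shows "generates B S = generates A S"
  by (simp add: generates_def assms)

text \<open>The set on which two homomorphisms agree is a subalgebra.\<close>

lemma algebra_hom_eqI:
  assumes gen: "generates A S" "S \<subseteq> carrier A" and A: "complex_algebra A"
    and g: "g \<in> algebra_hom A B" and h: "h \<in> algebra_hom A B"
    and eq: "\<And>s. s \<in> S \<Longrightarrow> g s = h s"
    and x: "x \<in> carrier A"
  shows "g x = h x"
proof -
  interpret complex_algebra A by fact
  have "carrier A \<subseteq> {x \<in> carrier A. g x = h x}"
    using gen(2)
    by (intro gen(1)[unfolded generates_def, rule_format])
      (auto simp: eq algebra_hom_simps[OF g] algebra_hom_simps[OF h])
  with x show ?thesis
    by blast
qed

text \<open>The preimage of a closed set K is closed and contains S, hence is all of A.\<close>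

lemma generates_image:
  assumes gen: "generates A S" "S \<subseteq> carrier A" and A: "complex_algebra A"
    and h: "h \<in> algebra_hom A B" and surj: "h ` carrier A = carrier B"
  shows "generates B (h ` S)"
proof -
  interpret complex_algebra A by fact
  have "carrier B \<subseteq> K"
    if K: "h ` S \<subseteq> K" "\<one>\<^bsub>B\<^esub> \<in> K" "\<forall>x\<in>K. \<forall>y\<in>K. x \<oplus>\<^bsub>B\<^esub> y \<in> K" "\<forall>c. \<forall>x\<in>K. c \<odot>\<^bsub>B\<^esub> x \<in> K"
      "\<forall>x\<in>K. \<forall>y\<in>K. x \<otimes>\<^bsub>B\<^esub> y \<in> K" for K
  proof -
    have "carrier A \<subseteq> {x \<in> carrier A. h x \<in> K}"
      using gen(2) K
      by (intro gen(1)[unfolded generates_def, rule_format])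
        (auto simp: algebra_hom_simps[OF h])
    then show ?thesis
      unfolding surj[symmetric] by blast
  qed
  then show ?thesis
    by (simp add: generates_def)
qed

section \<open>Quotients\<close>

lemma submodule_Int:
  assumes "module complex_field V" "\<N> \<noteq> {}" "\<And>N. N \<in> \<N> \<Longrightarrow> submodule N complex_field V"
  shows "submodule (\<Inter>\<N>) complex_field V"
proof -
  interpret module complex_field V by fact
  note E = submoduleE[OF assms(3)]
  show ?thesis
  proof (rule submoduleI)
    show "\<Inter>\<N> \<subseteq> carrier V"
      using E(1) assms(2) by blast
    show "\<zero>\<^bsub>V\<^esub> \<in> \<Inter>\<N>"
    proof
      fix N assume N: "N \<in> \<N>"
      then interpret subgroup N "add_monoid V"
        using assms(3) submodule.axioms(1) by blast
      show "\<zero>\<^bsub>V\<^esub> \<in> N"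
        using one_closed by simp
    qed
    show "\<ominus>\<^bsub>V\<^esub> a \<in> \<Inter>\<N>" if "a \<in> \<Inter>\<N>" for a
      using E(3) that by blast
    show "a \<oplus>\<^bsub>V\<^esub> b \<in> \<Inter>\<N>" if "a \<in> \<Inter>\<N>" "b \<in> \<Inter>\<N>" for a b
      using E(5) that by blast
    show "c \<odot>\<^bsub>V\<^esub> a \<in> \<Inter>\<N>" if "c \<in> carrier complex_field" "a \<in> \<Inter>\<N>" for c a
      using E(4) that by blast
  qed
qed

locale submodule_quotient = module complex_field V for V (structure) +
  fixes N
  assumes submod: "submodule N complex_field V"
begin

sublocale abelian_subgroup N V
  by (rule abelian_subgroupI3[OF additive_subgroup.intro M.abelian_group_axioms])
    (rule submodule.axioms(1)[OF submod])

lemma quotient_carrierE: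
  assumes "C \<in> carrier (quotient V N)"
  obtains x where "x \<in> carrier V" "C = N +> x"
  using assms by (auto simp: quotient_def FactRing_def A_RCOSETS_def RCOSETS_def a_r_coset_def)

lemma quotient_carrier: "carrier (quotient V N) = (\<lambda>x. N +> x) ` carrier V"
  by (auto simp: quotient_def FactRing_def A_RCOSETS_def RCOSETS_def a_r_coset_def)

lemma coset_closed [simp]: "x \<in> carrier V \<Longrightarrow> N +> x \<in> carrier (quotient V N)"
  by (simp add: quotient_carrier)

lemma quotient_zero: "\<zero>\<^bsub>quotient V N\<^esub> = N"
  by (simp add: quotient_def FactRing_def)

lemma quotient_add:
  "\<lbrakk>x \<in> carrier V; y \<in> carrier V\<rbrakk> \<Longrightarrow> (N +> x) \<oplus>\<^bsub>quotient V N\<^esub> (N +> y) = N +> (x \<oplus> y)"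
  by (simp add: quotient_def FactRing_def a_rcos_sum)

lemma coset_mem: "x \<in> carrier V \<Longrightarrow> y \<in> N +> x \<longleftrightarrow> (\<exists>n\<in>N. y = n \<oplus> x)"
  by (auto simp: a_r_coset_def r_coset_def)

lemma coset_absorb: "\<lbrakk>n \<in> N; x \<in> carrier V\<rbrakk> \<Longrightarrow> N +> (n \<oplus> x) = N +> x"
  using a_repr_independence[OF _ _ a_subgroup, of "n \<oplus> x" x]
  by (auto simp: coset_mem)

lemma coset_zero: "n \<in> N \<Longrightarrow> N +> n = N"
  using a_coset_join2[OF a_Hcarr a_subgroup] by blast

text \<open>The union in \<open>quotient\<close> runs over all representatives of a coset. Each
  contributes the same coset, because N is stable under scalars.\<close>

lemma quotient_smult:
  assumes "x \<in> carrier V"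
  shows "c \<odot>\<^bsub>quotient V N\<^esub> (N +> x) = N +> (c \<odot> x)"
proof -
  interpret submodule N complex_field V
    by (rule submod)
  have eq: "N +> (c \<odot> y) = N +> (c \<odot> x)" if y: "y \<in> N +> x" for y
  proof -
    obtain n where n: "n \<in> N" "y = n \<oplus> x"
      using y assms by (auto simp: coset_mem)
    have "c \<odot> y = c \<odot> n \<oplus> c \<odot> x"
      using n assms by (simp add: smult_r_distr)
    then show ?thesis
      using n assms by (simp add: coset_absorb)
  qed
  have "x \<in> N +> x"
    by (rule a_rcos_self[OF assms])
  with eq have "(\<Union>y\<in>N +> x. N +> (c \<odot> y)) = N +> (c \<odot> x)"
    by blast
  then show ?thesis
    by (simp add: quotient_def)
qed

lemmas quotient_simps = quotient_add quotient_smult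

lemma module_quotient: "module complex_field (quotient V N)"
proof (rule complex_moduleI)
  \<comment> \<open>The zero of the quotient is literally the set N; written as a coset it fits the
    rules for cosets.\<close>
  have N: "N = N +> \<zero>"
    by (rule coset_zero[symmetric]) simp
  show "\<zero>\<^bsub>quotient V N\<^esub> \<in> carrier (quotient V N)"
    by (subst quotient_zero, subst N) simp
  show "\<zero>\<^bsub>quotient V N\<^esub> \<oplus>\<^bsub>quotient V N\<^esub> C = C" if "C \<in> carrier (quotient V N)" for C
    using that by (elim quotient_carrierE) (simp add: quotient_zero, subst N, simp add: quotient_add)
  show "0 \<odot>\<^bsub>quotient V N\<^esub> C = \<zero>\<^bsub>quotient V N\<^esub>" if "C \<in> carrier (quotient V N)" for C
    using that smult_l_null[simplified]
    by (elim quotient_carrierE) (simp add: quotient_zero quotient_smult N[symmetric])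
  fix c d :: complex and C D E
  let ?Q = "quotient V N"
  assume C: "C \<in> carrier ?Q"
  then obtain x where x: "x \<in> carrier V" "C = N +> x"
    by (rule quotient_carrierE)
  show "c \<odot>\<^bsub>?Q\<^esub> C \<in> carrier ?Q" "1 \<odot>\<^bsub>?Q\<^esub> C = C"
    using x smult_one[of x] by (simp_all add: quotient_simps)
  show "(c + d) \<odot>\<^bsub>?Q\<^esub> C = c \<odot>\<^bsub>?Q\<^esub> C \<oplus>\<^bsub>?Q\<^esub> d \<odot>\<^bsub>?Q\<^esub> C"
    using x smult_l_distr[of c d x] by (simp add: quotient_simps)
  show "(c * d) \<odot>\<^bsub>?Q\<^esub> C = c \<odot>\<^bsub>?Q\<^esub> (d \<odot>\<^bsub>?Q\<^esub> C)"
    using x smult_assoc1[of c d x] by (simp add: quotient_simps)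
  assume D: "D \<in> carrier ?Q"
  then obtain y where y: "y \<in> carrier V" "D = N +> y"
    by (rule quotient_carrierE)
  show "C \<oplus>\<^bsub>?Q\<^esub> D \<in> carrier ?Q"
    using x y by (simp add: quotient_simps)
  show "C \<oplus>\<^bsub>?Q\<^esub> D = D \<oplus>\<^bsub>?Q\<^esub> C"
    using x y by (simp add: quotient_simps M.a_comm)
  show "c \<odot>\<^bsub>?Q\<^esub> (C \<oplus>\<^bsub>?Q\<^esub> D) = c \<odot>\<^bsub>?Q\<^esub> C \<oplus>\<^bsub>?Q\<^esub> c \<odot>\<^bsub>?Q\<^esub> D"
    using x y by (simp add: quotient_simps smult_r_distr)
  assume "E \<in> carrier ?Q"
  then obtain z where z: "z \<in> carrier V" "E = N +> z"
    by (rule quotient_carrierE)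
  show "(C \<oplus>\<^bsub>?Q\<^esub> D) \<oplus>\<^bsub>?Q\<^esub> E = C \<oplus>\<^bsub>?Q\<^esub> (D \<oplus>\<^bsub>?Q\<^esub> E)"
    using x y z by (simp add: quotient_simps M.a_assoc)
qed

lemma linear_map_coset: "linear_map V (quotient V N) (\<lambda>x. N +> x)"
  by (rule linear_mapI) (simp_all add: quotient_simps)

text \<open>A linear map that kills N is constant on each coset, so the image of the coset is a
  singleton and \<open>the_elem\<close> returns its value.\<close>

lemma induced_coset:
  assumes h: "linear_map V W h" and W: "module complex_field W"
    and null: "\<And>n. n \<in> N \<Longrightarrow> h n = \<zero>\<^bsub>W\<^esub>" and x: "x \<in> carrier V"
  shows "induced h (N +> x) = h x"
proof -
  interpret W: module complex_field W by fact
  have "h y = h x" if "y \<in> N +> x" for y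
    using that x by (auto simp: coset_mem null linear_map_simps[OF h])
  then have "h ` (N +> x) = {h x}"
    using a_rcos_self[OF x] by blast
  then show ?thesis
    by (simp add: induced_def)
qed

lemma linear_map_induced:
  assumes h: "linear_map V W h" and W: "module complex_field W"
    and null: "\<And>n. n \<in> N \<Longrightarrow> h n = \<zero>\<^bsub>W\<^esub>"
  shows "linear_map (quotient V N) W (induced h)"
proof (rule linear_mapI)
qed (elim quotient_carrierE; simp add: quotient_simps induced_coset[OF assms]
      linear_map_simps[OF h])+

end

text \<open>This is how a map is shown to factor: \<open>tensor_null\<close> is the smallest
  submodule containing the relators, so it lies in every kernel that contains them.\<close>

lemma linear_map_kernel_submodule:
  assumes h: "linear_map V W h" and V: "module complex_field V" and W: "module complex_field W"
  shows "submodule {x \<in> carrier V. h x = \<zero>\<^bsub>W\<^esub>} complex_field V"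
proof -
  interpret V: module complex_field V by fact
  interpret W: module complex_field W by fact
  have minus: "\<ominus>\<^bsub>V\<^esub> a = (- 1) \<odot>\<^bsub>V\<^esub> a" if "a \<in> carrier V" for a
  proof -
    have "(- 1) \<odot>\<^bsub>V\<^esub> a \<oplus>\<^bsub>V\<^esub> a = \<zero>\<^bsub>V\<^esub>"
      using V.smult_l_distr[of "-1" 1 a] V.smult_l_null[of a] V.smult_one[of a] that by simp
    then show ?thesis
      using that V.minus_equality V.smult_closed by simp
  qed
  show ?thesis
    by (rule V.submoduleI)
      (use W.smult_r_null in \<open>auto simp: minus linear_map_simps[OF h] linear_map_zero[OF assms]\<close>)
qed

section \<open>Quotient algebras and presentations\<close>

locale algebra_quotient = complex_algebra A + ideal I A for A (structure) and I
begin

lemma ideal_submodule: "submodule I complex_field A"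
proof (rule submoduleI)
  fix c x assume x: "x \<in> I"
  have "c \<odot> x = (c \<odot> \<one>) \<otimes> x"
    using x by (simp add: smult_mult_left)
  also have "\<dots> \<in> I"
    by (rule I_l_closed[OF x]) simp
  finally show "c \<odot> x \<in> I" .
qed (use a_subset in auto)

sublocale submodule_quotient A I
  by (intro submodule_quotient.intro submodule_quotient_axioms.intro module_axioms ideal_submodule)

lemma quotient_mult:
  "\<lbrakk>x \<in> carrier A; y \<in> carrier A\<rbrakk> \<Longrightarrow> (I +> x) \<otimes>\<^bsub>quotient A I\<^esub> (I +> y) = I +> (x \<otimes> y)"
  by (simp add: quotient_def FactRing_def rcoset_mult_add)

lemma quotient_one: "\<one>\<^bsub>quotient A I\<^esub> = I +> \<one>"
  by (simp add: quotient_def FactRing_def)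

lemma complex_algebra_quotient: "complex_algebra (quotient A I)"
  by (rule complex_algebraI[OF module_quotient])
    ((elim quotient_carrierE)?; simp add: quotient_simps quotient_mult quotient_one m_assoc
      l_distr r_distr smult_mult_left smult_mult_right)+

lemma algebra_hom_coset: "(\<lambda>x. I +> x) \<in> algebra_hom A (quotient A I)"
  by (rule algebra_homI[OF linear_map_coset]) (simp_all add: quotient_mult quotient_one)

end

lemma algebra_hom_kernel_ideal:
  assumes h: "h \<in> algebra_hom A B" and A: "complex_algebra A" and B: "complex_algebra B"
  shows "ideal {x \<in> carrier A. h x = \<zero>\<^bsub>B\<^esub>} A"
proof -
  interpret A: complex_algebra A by fact
  interpret B: complex_algebra B by fact
  have "submodule {x \<in> carrier A. h x = \<zero>\<^bsub>B\<^esub>} complex_field A"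
    by (rule linear_map_kernel_submodule[OF algebra_hom_linear[OF h] A.module_axioms B.module_axioms])
  then show ?thesis
    by (intro idealI A.ring_axioms submodule.axioms(1)) (auto simp: algebra_hom_simps[OF h])
qed

text \<open>The universal property of an algebra modulo relators: the kernel of a homomorphism is an
  ideal, so it contains \<open>Idl S\<close> once it contains S. It serves twice, for the free
  algebra modulo the relations of H and for H modulo the l-th powers of the D_i.\<close>

locale presented_algebra = complex_algebra A for A (structure) +
  fixes S
  assumes relators_closed: "S \<subseteq> carrier A"
begin

sublocale algebra_quotient A "Idl S"
  by (intro algebra_quotient.intro complex_algebra_axioms genideal_ideal relators_closed)

lemma relator_coset: "s \<in> S \<Longrightarrow> Idl S +> s = \<zero>\<^bsub>quotient A (Idl S)\<^esub>"
  using genideal_self[OF relators_closed] by (simp add: quotient_zero coset_zero subsetD)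

context
  fixes B h
  assumes B: "complex_algebra B" and h: "h \<in> algebra_hom A B"
    and relators: "\<And>s. s \<in> S \<Longrightarrow> h s = \<zero>\<^bsub>B\<^esub>"
begin

lemma hom_vanishes: "x \<in> Idl S \<Longrightarrow> h x = \<zero>\<^bsub>B\<^esub>"
  using genideal_minimal[OF algebra_hom_kernel_ideal[OF h complex_algebra_axioms B], of S]
    relators relators_closed by blast

lemma induced_relators:
  assumes "x \<in> carrier A"
  shows "induced h (Idl S +> x) = h x"
proof -
  interpret B: complex_algebra B by (rule B)
  show ?thesis
    by (rule induced_coset[OF algebra_hom_linear[OF h] B.module_axioms hom_vanishes assms])
qed

lemma algebra_hom_induced: "induced h \<in> algebra_hom (quotient A (Idl S)) B"
proof (rule algebra_homI)
  interpret B: complex_algebra B by (rule B)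
  show "linear_map (quotient A (Idl S)) B (induced h)"
    by (rule linear_map_induced[OF algebra_hom_linear[OF h] B.module_axioms hom_vanishes])
  show "induced h (x \<otimes>\<^bsub>quotient A (Idl S)\<^esub> y) = induced h x \<otimes>\<^bsub>B\<^esub> induced h y"
    if "x \<in> carrier (quotient A (Idl S))" "y \<in> carrier (quotient A (Idl S))" for x y
    using that
    by (elim quotient_carrierE) (simp add: quotient_mult induced_relators algebra_hom_mult[OF h])
  show "induced h \<one>\<^bsub>quotient A (Idl S)\<^esub> = \<one>\<^bsub>B\<^esub>"
    by (simp add: quotient_one induced_relators algebra_hom_one[OF h])
qed

end

end

section \<open>Free modules\<close>

lemma lookup_scale [simp]: "Poly_Mapping.lookup (scale c p) k = c * Poly_Mapping.lookup p k"
  by (simp add: scale_def Poly_Mapping.map.rep_eq when_def)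

lemma scale_single: "scale c (Poly_Mapping.single k d) = Poly_Mapping.single k (c * d)"
  by (rule poly_mapping_eqI) (simp add: lookup_single when_def)

lemma keys_scale: "Poly_Mapping.keys (scale c p) \<subseteq> Poly_Mapping.keys p"
  by (auto simp: in_keys_iff)

lemma free_module_simps [simp]:
  "carrier (free_module S) = {p. Poly_Mapping.keys p \<subseteq> S}"
  "\<zero>\<^bsub>free_module S\<^esub> = 0" "x \<oplus>\<^bsub>free_module S\<^esub> y = x + y" "c \<odot>\<^bsub>free_module S\<^esub> x = scale c x"
  by (simp_all add: free_module_def)

lemma module_free_module: "module complex_field (free_module S)"
proof (rule complex_moduleI)
  fix x y :: "'a \<Rightarrow>\<^sub>0 complex"
  assume "x \<in> carrier (free_module S)" "y \<in> carrier (free_module S)"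
  then show "x \<oplus>\<^bsub>free_module S\<^esub> y \<in> carrier (free_module S)"
    using Poly_Mapping.keys_add[of x y] by auto
next
  fix c and x :: "'a \<Rightarrow>\<^sub>0 complex"
  assume "x \<in> carrier (free_module S)"
  then show "c \<odot>\<^bsub>free_module S\<^esub> x \<in> carrier (free_module S)"
    using keys_scale[of c x] by auto
qed (auto simp: lookup_add algebra_simps intro!: poly_mapping_eqI)

text \<open>A finitely supported function is a sum of singletons. The bound S on the support is
  carried along so that the induction stays inside the carrier of
  \<open>free_module S\<close>.\<close>

lemma poly_mapping_span_induct [consumes 1, case_names zero single add]:
  assumes "Poly_Mapping.keys p \<subseteq> S"
    and zero: "P 0"
    and single: "\<And>k c. k \<in> S \<Longrightarrow> P (Poly_Mapping.single k c)"
    and add: "\<And>p q. \<lbrakk>Poly_Mapping.keys p \<subseteq> S; Poly_Mapping.keys q \<subseteq> S; P p; P q\<rbrakk> \<Longrightarrow> P (p + q)"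
  shows "P p"
  using assms(1)
proof (induction p rule: Poly_Mapping.update_induct)
  case (update f a b)
  \<comment> \<open>The key is fresh, so updating is the same as adding a singleton.\<close>
  have eq: "Poly_Mapping.update a b f = f + Poly_Mapping.single a b"
    using update(1)
    by (intro poly_mapping_eqI)
      (auto simp: lookup_update lookup_add lookup_single when_def in_keys_iff)
  have "Poly_Mapping.keys f \<subseteq> S" "a \<in> S"
    using update by (auto simp: keys_update)
  with update show ?case
    by (simp add: eq add single)
qed (rule zero)

context
  fixes V :: "(complex, 'v, 'm) module_scheme" (structure) and S :: "'k set" and f :: "'k \<Rightarrow> 'v"
  assumes V: "module complex_field V" and f: "\<And>k. k \<in> S \<Longrightarrow> f k \<in> carrier V"
begin

interpretation module complex_field V
  by (rule V)

text \<open>The index set of the sum depends on p. Padding with zero coefficients lets p, q and p +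
  q be summed over one common set.\<close>

lemma linear_ext_superset:
  assumes "finite T" "Poly_Mapping.keys p \<subseteq> T" "T \<subseteq> S"
  shows "linear_ext V f p = (\<Oplus>k\<in>T. Poly_Mapping.lookup p k \<odot> f k)"
  unfolding linear_ext_def
  by (rule M.add.finprod_mono_neutral_cong_left)
    (use assms f smult_l_null in \<open>auto simp: in_keys_iff subset_iff\<close>)

lemma linear_ext_single:
  assumes "k \<in> S"
  shows "linear_ext V f (Poly_Mapping.single k c) = c \<odot> f k"
  using assms f by (subst linear_ext_superset[of "{k}"]) simp_all

lemma linear_map_linear_ext: "linear_map (free_module S) V (linear_ext V f)"
proof (rule linear_mapI)
  fix p q c assume p: "p \<in> carrier (free_module S)"
  let ?P = "Poly_Mapping.keys p"
  show "linear_ext V f p \<in> carrier V"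
    using p f unfolding linear_ext_def by (auto intro!: M.finsum_closed)
  have "linear_ext V f (scale c p) = (\<Oplus>k\<in>?P. c \<odot> (Poly_Mapping.lookup p k \<odot> f k))"
    using p f keys_scale[of c p] smult_assoc1
    by (subst linear_ext_superset[of ?P]) (auto intro!: M.finsum_cong' simp: subset_iff)
  also have "\<dots> = c \<odot> linear_ext V f p"
    using p f unfolding linear_ext_def
    by (intro finsum_smult_ldistr[symmetric]) auto
  finally show "linear_ext V f (c \<odot>\<^bsub>free_module S\<^esub> p) = c \<odot> linear_ext V f p"
    by simp
  assume q: "q \<in> carrier (free_module S)"
  let ?T = "?P \<union> Poly_Mapping.keys q"
  have T: "finite ?T" "?P \<subseteq> ?T" "Poly_Mapping.keys q \<subseteq> ?T" "?T \<subseteq> S"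
    using p q by auto
  have "linear_ext V f (p + q) =
      (\<Oplus>k\<in>?T. Poly_Mapping.lookup p k \<odot> f k \<oplus> Poly_Mapping.lookup q k \<odot> f k)"
    unfolding linear_ext_superset[OF T(1) Poly_Mapping.keys_add T(4)]
    by (rule M.finsum_cong') (use T f smult_l_distr in \<open>auto simp: subset_iff lookup_add\<close>)
  also have "\<dots> = linear_ext V f p \<oplus> linear_ext V f q"
    using T f by (subst (1 2) linear_ext_superset[of ?T]) (auto intro!: M.finsum_addf)
  finally show "linear_ext V f (p \<oplus>\<^bsub>free_module S\<^esub> q) = linear_ext V f p \<oplus> linear_ext V f q"
    by simp
qed

text \<open>The bilinear relators are written with the subtraction of finitely supported functions,
  which has to be translated into subtraction in V.\<close>

lemma linear_ext_diff:
  assumes "Poly_Mapping.keys p \<subseteq> S" "Poly_Mapping.keys q \<subseteq> S"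
  shows "linear_ext V f (p - q) = linear_ext V f p \<ominus> linear_ext V f q"
proof -
  note L = linear_map_simps[OF linear_map_linear_ext, simplified]
  have pq: "Poly_Mapping.keys (p - q) \<subseteq> S"
    using assms Poly_Mapping.keys_diff[of p q] by blast
  have "linear_ext V f p = linear_ext V f (p - q) \<oplus> linear_ext V f q"
    using L(2)[OF pq assms(2)] by simp
  moreover have "linear_ext V f (p - q) \<in> carrier V" "linear_ext V f q \<in> carrier V"
    using L(1) pq assms by auto
  ultimately show ?thesis
    by (simp add: M.minus_eq M.a_assoc M.r_neg)
qed

end

section \<open>Tensor products\<close>

locale tensor_product = A: module complex_field A + B: module complex_field B
  for A :: "(complex, 'a, 'm) module_scheme" and B :: "(complex, 'b, 'n) module_scheme"
begin

abbreviation F where "F \<equiv> free_module (carrier A \<times> carrier B)"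

sublocale F: module complex_field F
  by (rule module_free_module)

lemma relators_closed: "bilinear_relators A B \<subseteq> carrier F"
proof -
  have diff: "k \<in> Poly_Mapping.keys x \<or> k \<in> Poly_Mapping.keys y"
    if "k \<in> Poly_Mapping.keys (x - y)" for k and x y :: "'a \<times> 'b \<Rightarrow>\<^sub>0 complex"
    using that Poly_Mapping.keys_diff[of x y] by blast
  show ?thesis
    unfolding bilinear_relators_def Let_def
    by (auto simp: scale_single split: if_splits dest!: diff)
qed

lemma submodule_null: "submodule (tensor_null A B) complex_field F"
  unfolding tensor_null_def
  by (rule submodule_Int[OF F.module_axioms]) (use F.carrier_is_submodule relators_closed in auto)

lemma relators_null: "bilinear_relators A B \<subseteq> tensor_null A B"
  by (auto simp: tensor_null_def)

sublocale Q: submodule_quotient F "tensor_null A B"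
  by (intro submodule_quotient.intro submodule_quotient_axioms.intro F.module_axioms submodule_null)

lemma tensor_fields:
  "carrier (A \<boxtimes> B) = carrier (tensor_module A B)" "add (A \<boxtimes> B) = add (tensor_module A B)"
  "ring.zero (A \<boxtimes> B) = ring.zero (tensor_module A B)"
  "module.smult (A \<boxtimes> B) = module.smult (tensor_module A B)"
  by (simp_all add: tensor_algebra_def)

lemma linear_map_tensor_module:
  "linear_map (tensor_module A B) V h = linear_map (A \<boxtimes> B) V h"
  "linear_map V (tensor_module A B) g = linear_map V (A \<boxtimes> B) g"
  by (simp_all add: linear_map_def tensor_fields)

lemma tensor_module: "module complex_field (tensor_module A B)"
  unfolding tensor_module_def by (rule Q.module_quotient)

sublocale T: module complex_field "A \<boxtimes> B"
  by (rule module_cong[OF tensor_module]) (simp_all add: tensor_fields)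

text \<open>A relator r = x - y - z gives x = r + (y + z), and r is absorbed by the coset. Each
  additivity law of the tensor symbol is an instance.\<close>

lemma coset_add:
  assumes "r \<in> bilinear_relators A B" "r = x - y - z"
    "Poly_Mapping.keys y \<subseteq> carrier A \<times> carrier B" "Poly_Mapping.keys z \<subseteq> carrier A \<times> carrier B"
  shows "tensor_null A B +>\<^bsub>F\<^esub> x =
    (tensor_null A B +>\<^bsub>F\<^esub> y) \<oplus>\<^bsub>A \<boxtimes> B\<^esub> (tensor_null A B +>\<^bsub>F\<^esub> z)"
proof -
  have "y + z \<in> carrier F"
    using assms(3,4) Poly_Mapping.keys_add[of y z] by auto
  then have "tensor_null A B +>\<^bsub>F\<^esub> (r \<oplus>\<^bsub>F\<^esub> (y + z)) = tensor_null A B +>\<^bsub>F\<^esub> (y \<oplus>\<^bsub>F\<^esub> z)"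
    using assms(1) relators_null by (subst Q.coset_absorb) auto
  then show ?thesis
    using assms Q.quotient_add[of y z] by (simp add: tensor_fields tensor_module_def)
qed

lemma coset_smult:
  assumes "r \<in> bilinear_relators A B" "r = x - scale c y"
    "Poly_Mapping.keys y \<subseteq> carrier A \<times> carrier B"
  shows "tensor_null A B +>\<^bsub>F\<^esub> x = c \<odot>\<^bsub>A \<boxtimes> B\<^esub> (tensor_null A B +>\<^bsub>F\<^esub> y)"
proof -
  have "scale c y \<in> carrier F"
    using assms(3) keys_scale[of c y] by auto
  then have "tensor_null A B +>\<^bsub>F\<^esub> (r \<oplus>\<^bsub>F\<^esub> scale c y) = tensor_null A B +>\<^bsub>F\<^esub> (c \<odot>\<^bsub>F\<^esub> y)"
    using assms(1) relators_null by (subst Q.coset_absorb) auto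
  then show ?thesis
    using assms Q.quotient_smult[of y c] by (simp add: tensor_fields tensor_module_def)
qed

lemma tensor_closed [simp, intro]:
  "\<lbrakk>a \<in> carrier A; b \<in> carrier B\<rbrakk> \<Longrightarrow> tensor A B a b \<in> carrier (A \<boxtimes> B)"
  unfolding tensor_def tensor_fields tensor_module_def by (rule Q.coset_closed) simp

lemma tensor_bilinear: "bilinear_map A B (A \<boxtimes> B) (tensor A B)"
proof -
  note defs = bilinear_relators_def Let_def
  have "tensor A B (a \<oplus>\<^bsub>A\<^esub> a') b = tensor A B a b \<oplus>\<^bsub>A \<boxtimes> B\<^esub> tensor A B a' b"
    if "a \<in> carrier A" "a' \<in> carrier A" "b \<in> carrier B" for a a' b
    unfolding tensor_def by (rule coset_add[OF _ refl]) (use that in \<open>auto simp: defs\<close>)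
  moreover have "tensor A B a (b \<oplus>\<^bsub>B\<^esub> b') = tensor A B a b \<oplus>\<^bsub>A \<boxtimes> B\<^esub> tensor A B a b'"
    if "a \<in> carrier A" "b \<in> carrier B" "b' \<in> carrier B" for a b b'
    unfolding tensor_def by (rule coset_add[OF _ refl]) (use that in \<open>auto simp: defs\<close>)
  moreover have "tensor A B (c \<odot>\<^bsub>A\<^esub> a) b = c \<odot>\<^bsub>A \<boxtimes> B\<^esub> tensor A B a b"
    if "a \<in> carrier A" "b \<in> carrier B" for c a b
    unfolding tensor_def by (rule coset_smult[OF _ refl]) (use that in \<open>auto simp: defs\<close>)
  moreover have "tensor A B a (c \<odot>\<^bsub>B\<^esub> b) = c \<odot>\<^bsub>A \<boxtimes> B\<^esub> tensor A B a b"
    if "a \<in> carrier A" "b \<in> carrier B" for c a b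
    unfolding tensor_def by (rule coset_smult[OF _ refl]) (use that in \<open>auto simp: defs\<close>)
  ultimately show ?thesis
    by (intro bilinear_mapI linear_mapI) simp_all
qed

lemmas tensor_linear_left = bilinear_mapD(2)[OF tensor_bilinear]
lemmas tensor_linear_right = bilinear_mapD(1)[OF tensor_bilinear]

lemma tensor_add_left:
  "\<lbrakk>a \<in> carrier A; a' \<in> carrier A; b \<in> carrier B\<rbrakk> \<Longrightarrow>
    tensor A B (a \<oplus>\<^bsub>A\<^esub> a') b = tensor A B a b \<oplus>\<^bsub>A \<boxtimes> B\<^esub> tensor A B a' b"
  and tensor_add_right:
  "\<lbrakk>a \<in> carrier A; b \<in> carrier B; b' \<in> carrier B\<rbrakk> \<Longrightarrow>
    tensor A B a (b \<oplus>\<^bsub>B\<^esub> b') = tensor A B a b \<oplus>\<^bsub>A \<boxtimes> B\<^esub> tensor A B a b'"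
  and tensor_smult_left:
  "\<lbrakk>a \<in> carrier A; b \<in> carrier B\<rbrakk> \<Longrightarrow>
    tensor A B (c \<odot>\<^bsub>A\<^esub> a) b = c \<odot>\<^bsub>A \<boxtimes> B\<^esub> tensor A B a b"
  and tensor_smult_right:
  "\<lbrakk>a \<in> carrier A; b \<in> carrier B\<rbrakk> \<Longrightarrow>
    tensor A B a (c \<odot>\<^bsub>B\<^esub> b) = c \<odot>\<^bsub>A \<boxtimes> B\<^esub> tensor A B a b"
  using tensor_linear_left tensor_linear_right by (auto simp: linear_map_def)

lemma tensor_zero_left: "b \<in> carrier B \<Longrightarrow> tensor A B \<zero>\<^bsub>A\<^esub> b = \<zero>\<^bsub>A \<boxtimes> B\<^esub>"
  by (rule linear_map_zero[OF tensor_linear_left A.module_axioms T.module_axioms])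

lemma tensor_zero_right: "a \<in> carrier A \<Longrightarrow> tensor A B a \<zero>\<^bsub>B\<^esub> = \<zero>\<^bsub>A \<boxtimes> B\<^esub>"
  by (rule linear_map_zero[OF tensor_linear_right B.module_axioms T.module_axioms])

lemmas tensor_simps =
  tensor_add_left tensor_add_right tensor_smult_left tensor_smult_right
  tensor_zero_left tensor_zero_right

text \<open>Every element is the coset of a linear combination of pairs, hence a linear combination
  of pure tensors. Zero needs no case of its own, since it is 0 times a pure tensor.\<close>

lemma tensor_induct [consumes 1, case_names tensor add smult]:
  assumes x: "x \<in> carrier (A \<boxtimes> B)"
    and tensor: "\<And>a b. \<lbrakk>a \<in> carrier A; b \<in> carrier B\<rbrakk> \<Longrightarrow> P (tensor A B a b)"
    and add: "\<And>x y. \<lbrakk>x \<in> carrier (A \<boxtimes> B); y \<in> carrier (A \<boxtimes> B); P x; P y\<rbrakk> \<Longrightarrow> P (x \<oplus>\<^bsub>A \<boxtimes> B\<^esub> y)"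
    and smult: "\<And>c x. \<lbrakk>x \<in> carrier (A \<boxtimes> B); P x\<rbrakk> \<Longrightarrow> P (c \<odot>\<^bsub>A \<boxtimes> B\<^esub> x)"
  shows "P x"
proof -
  let ?c = "\<lambda>p. tensor_null A B +>\<^bsub>F\<^esub> p"
  have L: "linear_map F (A \<boxtimes> B) ?c"
    using Q.linear_map_coset by (simp add: linear_map_tensor_module(2)[symmetric] tensor_module_def)
  have P_single: "P (?c (Poly_Mapping.single k c))" if k: "k \<in> carrier A \<times> carrier B" for k c
  proof -
    obtain a b where ab: "k = (a, b)" "a \<in> carrier A" "b \<in> carrier B"
      using k by blast
    have "?c (scale c (Poly_Mapping.single k 1)) = c \<odot>\<^bsub>A \<boxtimes> B\<^esub> tensor A B a b"
      using ab linear_map_smult[OF L, of "Poly_Mapping.single k 1"] by (simp add: tensor_def)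
    then show ?thesis
      using ab by (simp add: scale_single smult tensor)
  qed
  obtain p where p: "Poly_Mapping.keys p \<subseteq> carrier A \<times> carrier B" "x = ?c p"
    using x by (auto simp: tensor_fields tensor_module_def elim: Q.quotient_carrierE)
  have "P (?c p)"
    using p(1)
  proof (induction p rule: poly_mapping_span_induct)
    case zero
    have "P (?c (scale 0 (Poly_Mapping.single (\<zero>\<^bsub>A\<^esub>, \<zero>\<^bsub>B\<^esub>) 1)))"
      by (subst scale_single) (rule P_single, simp)
    moreover have "scale 0 (Poly_Mapping.single (\<zero>\<^bsub>A\<^esub>, \<zero>\<^bsub>B\<^esub>) 1) = 0"
      by (simp add: scale_single)
    ultimately show ?case
      by simp
  next
    case (add p q)
    then show ?case
      using linear_map_add[OF L, of p q] linear_map_closed[OF L] by (simp add: assms(3))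
  qed (rule P_single)
  then show ?thesis
    using p by simp
qed

context
  fixes V :: "(complex, 'v, 'l) module_scheme" and f
  assumes V: "module complex_field V" and f: "bilinear_map A B V f"
begin

interpretation V: module complex_field V
  by (rule V)

text \<open>The universal property: bilinearity of f says exactly that the linear extension of f
  kills the relators, so it kills \<open>tensor_null\<close> and descends to cosets.\<close>

lemma tensor_lift_properties:
  "linear_map (A \<boxtimes> B) V (tensor_lift V f)"
  "\<lbrakk>a \<in> carrier A; b \<in> carrier B\<rbrakk> \<Longrightarrow> tensor_lift V f (tensor A B a b) = f a b"
proof -
  define L where "L = linear_ext V (\<lambda>(a, b). f a b)"
  note fl = linear_map_simps[OF bilinear_mapD(1)[OF f]] linear_map_simps[OF bilinear_mapD(2)[OF f]]
  have fc: "\<And>k. k \<in> carrier A \<times> carrier B \<Longrightarrow> (case k of (a, b) \<Rightarrow> f a b) \<in> carrier V"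
    using fl by auto
  have L: "linear_map F V L"
    unfolding L_def by (rule linear_map_linear_ext[OF V fc])
  have single: "L (Poly_Mapping.single (a, b) c) = c \<odot>\<^bsub>V\<^esub> f a b"
    if "a \<in> carrier A" "b \<in> carrier B" for a b c
    using that unfolding L_def by (subst linear_ext_single[OF V fc]) auto
  have diff: "L (p - q) = L p \<ominus>\<^bsub>V\<^esub> L q" if "p \<in> carrier F" "q \<in> carrier F" for p q
    using that unfolding L_def by (intro linear_ext_diff[OF V fc]) auto
  have Fdiff: "p - q \<in> carrier F" if "p \<in> carrier F" "q \<in> carrier F" for p q
    using that Poly_Mapping.keys_diff[of p q] by auto
  have smult_one: "1 \<odot>\<^bsub>V\<^esub> x = x" if "x \<in> carrier V" for x
    using V.smult_one[OF that] by simp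
  \<comment> \<open>The relators come in two shapes: p - q for the scalar laws and p - q - r for the
    additive laws.\<close>
  have zero1: "L (p - q) = \<zero>\<^bsub>V\<^esub>" if "p \<in> carrier F" "q \<in> carrier F" "L p = L q" for p q
    using that linear_map_closed[OF L] by (simp add: diff V.M.minus_eq V.M.r_neg del: free_module_simps)
  have zero2: "L (p - q - r) = \<zero>\<^bsub>V\<^esub>"
    if "p \<in> carrier F" "q \<in> carrier F" "r \<in> carrier F" "L p = L q \<oplus>\<^bsub>V\<^esub> L r" for p q r
  proof -
    have "L (p - (q \<oplus>\<^bsub>F\<^esub> r)) = \<zero>\<^bsub>V\<^esub>"
      using that
      by (intro zero1 F.M.a_closed) (simp_all add: linear_map_add[OF L] del: free_module_simps)
    then show ?thesis
      by (simp add: diff_diff_eq)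
  qed
  have "bilinear_relators A B \<subseteq> {p \<in> carrier F. L p = \<zero>\<^bsub>V\<^esub>}"
  proof
    fix r assume r: "r \<in> bilinear_relators A B"
    have "L r = \<zero>\<^bsub>V\<^esub>"
      using r unfolding bilinear_relators_def Let_def scale_single
      by (elim UnE CollectE exE conjE; hypsubst; intro zero1 zero2)
        (simp_all add: single smult_one fl)
    then show "r \<in> {p \<in> carrier F. L p = \<zero>\<^bsub>V\<^esub>}"
      using r relators_closed by blast
  qed
  then have "tensor_null A B \<subseteq> {p \<in> carrier F. L p = \<zero>\<^bsub>V\<^esub>}"
    using linear_map_kernel_submodule[OF L F.module_axioms V] unfolding tensor_null_def by blast
  then have null: "\<And>n. n \<in> tensor_null A B \<Longrightarrow> L n = \<zero>\<^bsub>V\<^esub>"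
    by blast
  have lift: "tensor_lift V f = induced L"
    by (simp add: tensor_lift_def L_def)
  show "linear_map (A \<boxtimes> B) V (tensor_lift V f)"
    using Q.linear_map_induced[OF L V null]
    by (simp add: lift linear_map_tensor_module(1)[symmetric] tensor_module_def)
  show "tensor_lift V f (tensor A B a b) = f a b" if "a \<in> carrier A" "b \<in> carrier B"
    using that unfolding lift tensor_def
    by (subst Q.induced_coset[OF L V null]) (simp_all add: single smult_one fl)
qed

lemmas linear_map_tensor_lift = tensor_lift_properties(1)
lemmas tensor_lift_tensor = tensor_lift_properties(2)

end

end

section \<open>The multiplication on a tensor product\<close>

locale tensor_algebras = A: complex_algebra A + B: complex_algebra B
  for A :: "(complex, 'a, 'm) module_scheme" and B :: "(complex, 'b, 'n) module_scheme"
begin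

sublocale tensor_product A B
  by (intro tensor_product.intro A.module_axioms B.module_axioms)

text \<open>The product of \<open>A \<boxtimes> B\<close> is defined by lifts into the bare module
  \<open>tensor_module A B\<close>. A lift reads only the linear structure of its target, so these
  are also lifts into the algebra.\<close>

lemma tensor_lift_tensor_module:
  "tensor_lift (tensor_module A B) = tensor_lift (A \<boxtimes> B)"
  by (intro ext) (simp add: tensor_lift_def linear_ext_def[abs_def] finsum_def tensor_fields)

text \<open>Left multiplication by the pure tensor of a and b; the general product is its linear
  extension in the left factor.\<close>

definition tensor_mult :: "'a \<Rightarrow> 'b \<Rightarrow> ('a \<times> 'b \<Rightarrow>\<^sub>0 complex) set \<Rightarrow> ('a \<times> 'b \<Rightarrow>\<^sub>0 complex) set" where
  "tensor_mult a b =
     tensor_lift (A \<boxtimes> B) (\<lambda>a' b'. tensor A B (a \<otimes>\<^bsub>A\<^esub> a') (b \<otimes>\<^bsub>B\<^esub> b'))"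

lemma mult_eq: "x \<otimes>\<^bsub>A \<boxtimes> B\<^esub> y = tensor_lift (A \<boxtimes> B) (\<lambda>a b. tensor_mult a b y) x"
  unfolding tensor_mult_def tensor_lift_tensor_module[symmetric]
  by (simp add: tensor_algebra_def)

lemma one_eq: "\<one>\<^bsub>A \<boxtimes> B\<^esub> = tensor A B \<one>\<^bsub>A\<^esub> \<one>\<^bsub>B\<^esub>"
  by (simp add: tensor_algebra_def)

lemma bilinear_tensor_mult:
  assumes "a \<in> carrier A" "b \<in> carrier B"
  shows "bilinear_map A B (A \<boxtimes> B) (\<lambda>a' b'. tensor A B (a \<otimes>\<^bsub>A\<^esub> a') (b \<otimes>\<^bsub>B\<^esub> b'))"
  using assms
  by (intro bilinear_mapI linear_mapI)
    (simp_all add: A.r_distr B.r_distr A.smult_mult_right B.smult_mult_right tensor_simps)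

lemma tensor_mult_linear:
  "\<lbrakk>a \<in> carrier A; b \<in> carrier B\<rbrakk> \<Longrightarrow> linear_map (A \<boxtimes> B) (A \<boxtimes> B) (tensor_mult a b)"
  unfolding tensor_mult_def
  by (rule linear_map_tensor_lift[OF T.module_axioms bilinear_tensor_mult])

lemma tensor_mult_tensor:
  "\<lbrakk>a \<in> carrier A; b \<in> carrier B; a' \<in> carrier A; b' \<in> carrier B\<rbrakk> \<Longrightarrow>
    tensor_mult a b (tensor A B a' b') = tensor A B (a \<otimes>\<^bsub>A\<^esub> a') (b \<otimes>\<^bsub>B\<^esub> b')"
  unfolding tensor_mult_def
  by (rule tensor_lift_tensor[OF T.module_axioms bilinear_tensor_mult])

lemma tensor_mult_bilinear:
  assumes "y \<in> carrier (A \<boxtimes> B)"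
  shows "bilinear_map A B (A \<boxtimes> B) (\<lambda>a b. tensor_mult a b y)"
proof -
  note lin = linear_map_simps[OF tensor_mult_linear]
  have "tensor_mult (a \<oplus>\<^bsub>A\<^esub> a') b y = tensor_mult a b y \<oplus>\<^bsub>A \<boxtimes> B\<^esub> tensor_mult a' b y"
    if "a \<in> carrier A" "a' \<in> carrier A" "b \<in> carrier B" for a a' b
    using assms that
    by (induction rule: tensor_induct)
      (simp_all add: lin tensor_mult_tensor A.l_distr tensor_simps T.M.a_ac T.smult_r_distr)
  moreover have "tensor_mult a (b \<oplus>\<^bsub>B\<^esub> b') y = tensor_mult a b y \<oplus>\<^bsub>A \<boxtimes> B\<^esub> tensor_mult a b' y"
    if "a \<in> carrier A" "b \<in> carrier B" "b' \<in> carrier B" for a b b'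
    using assms that
    by (induction rule: tensor_induct)
      (simp_all add: lin tensor_mult_tensor B.l_distr tensor_simps T.M.a_ac T.smult_r_distr)
  moreover have "tensor_mult (c \<odot>\<^bsub>A\<^esub> a) b y = c \<odot>\<^bsub>A \<boxtimes> B\<^esub> tensor_mult a b y"
    if "a \<in> carrier A" "b \<in> carrier B" for c a b
    using assms that
  proof (induction rule: tensor_induct)
    case (smult d x)
    then show ?case
      \<comment> \<open>The scalars c and d have to change places: c (d x) = (c d) x = d (c
        x).\<close>
      using T.smult_assoc1[of c d] T.smult_assoc1[of d c] by (simp add: lin mult.commute)
  qed (simp_all add: lin tensor_mult_tensor A.smult_mult_left tensor_simps T.smult_r_distr)
  moreover have "tensor_mult a (c \<odot>\<^bsub>B\<^esub> b) y = c \<odot>\<^bsub>A \<boxtimes> B\<^esub> tensor_mult a b y"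
    if "a \<in> carrier A" "b \<in> carrier B" for c a b
    using assms that
  proof (induction rule: tensor_induct)
    case (smult d x)
    then show ?case
      using T.smult_assoc1[of c d] T.smult_assoc1[of d c] by (simp add: lin mult.commute)
  qed (simp_all add: lin tensor_mult_tensor B.smult_mult_left tensor_simps T.smult_r_distr)
  ultimately show ?thesis
    using assms by (intro bilinear_mapI linear_mapI) (simp_all add: lin)
qed

lemma mult_linear_left:
  "y \<in> carrier (A \<boxtimes> B) \<Longrightarrow> linear_map (A \<boxtimes> B) (A \<boxtimes> B) (\<lambda>x. x \<otimes>\<^bsub>A \<boxtimes> B\<^esub> y)"
  unfolding mult_eq by (rule linear_map_tensor_lift[OF T.module_axioms tensor_mult_bilinear])

lemma tensor_mult_eq:
  "\<lbrakk>a \<in> carrier A; b \<in> carrier B; y \<in> carrier (A \<boxtimes> B)\<rbrakk> \<Longrightarrow>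
    tensor A B a b \<otimes>\<^bsub>A \<boxtimes> B\<^esub> y = tensor_mult a b y"
  unfolding mult_eq by (rule tensor_lift_tensor[OF T.module_axioms tensor_mult_bilinear])

lemma tensor_mult:
  "\<lbrakk>a \<in> carrier A; b \<in> carrier B; a' \<in> carrier A; b' \<in> carrier B\<rbrakk> \<Longrightarrow>
    tensor A B a b \<otimes>\<^bsub>A \<boxtimes> B\<^esub> tensor A B a' b' = tensor A B (a \<otimes>\<^bsub>A\<^esub> a') (b \<otimes>\<^bsub>B\<^esub> b')"
  by (simp add: tensor_mult_eq tensor_mult_tensor)

lemma mult_linear_right:
  assumes x: "x \<in> carrier (A \<boxtimes> B)"
  shows "linear_map (A \<boxtimes> B) (A \<boxtimes> B) (\<lambda>y. x \<otimes>\<^bsub>A \<boxtimes> B\<^esub> y)"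
proof (rule linear_mapI)
  note lin = linear_map_simps[OF tensor_mult_linear] linear_map_simps[OF mult_linear_left]
  fix y z c assume y: "y \<in> carrier (A \<boxtimes> B)"
  show "x \<otimes>\<^bsub>A \<boxtimes> B\<^esub> y \<in> carrier (A \<boxtimes> B)"
    using x y by (simp add: lin)
  show "x \<otimes>\<^bsub>A \<boxtimes> B\<^esub> (c \<odot>\<^bsub>A \<boxtimes> B\<^esub> y) = c \<odot>\<^bsub>A \<boxtimes> B\<^esub> (x \<otimes>\<^bsub>A \<boxtimes> B\<^esub> y)"
    using x y
  proof (induction rule: tensor_induct)
    case (smult d x)
    then show ?case
      using T.smult_assoc1[of c d] T.smult_assoc1[of d c] by (simp add: lin mult.commute)
  qed (simp_all add: lin tensor_mult_eq T.smult_r_distr)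
  assume z: "z \<in> carrier (A \<boxtimes> B)"
  show "x \<otimes>\<^bsub>A \<boxtimes> B\<^esub> (y \<oplus>\<^bsub>A \<boxtimes> B\<^esub> z) = x \<otimes>\<^bsub>A \<boxtimes> B\<^esub> y \<oplus>\<^bsub>A \<boxtimes> B\<^esub> x \<otimes>\<^bsub>A \<boxtimes> B\<^esub> z"
    using x y z
    by (induction rule: tensor_induct) (simp_all add: lin tensor_mult_eq T.smult_r_distr T.M.a_ac)
qed

lemmas mult_simps = linear_map_simps[OF mult_linear_left] linear_map_simps[OF mult_linear_right]

text \<open>Associativity is linear in each factor, so it is reduced to pure tensors one factor at a
  time: \<open>pure\<close> treats the last factor, \<open>half\<close> the middle one, and the
  final induction the first.\<close>

lemma complex_algebra_tensor: "complex_algebra (A \<boxtimes> B)"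
proof (rule complex_algebraI[OF T.module_axioms])
  fix x y z c
  show one: "\<one>\<^bsub>A \<boxtimes> B\<^esub> \<in> carrier (A \<boxtimes> B)"
    by (simp add: one_eq)
  assume x: "x \<in> carrier (A \<boxtimes> B)"
  show "\<one>\<^bsub>A \<boxtimes> B\<^esub> \<otimes>\<^bsub>A \<boxtimes> B\<^esub> x = x" "x \<otimes>\<^bsub>A \<boxtimes> B\<^esub> \<one>\<^bsub>A \<boxtimes> B\<^esub> = x"
    using x one
    by (induction rule: tensor_induct) (simp_all add: mult_simps, simp_all add: one_eq tensor_mult)
  assume y: "y \<in> carrier (A \<boxtimes> B)"
  show "x \<otimes>\<^bsub>A \<boxtimes> B\<^esub> y \<in> carrier (A \<boxtimes> B)"
    "(c \<odot>\<^bsub>A \<boxtimes> B\<^esub> x) \<otimes>\<^bsub>A \<boxtimes> B\<^esub> y = c \<odot>\<^bsub>A \<boxtimes> B\<^esub> (x \<otimes>\<^bsub>A \<boxtimes> B\<^esub> y)"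
    "x \<otimes>\<^bsub>A \<boxtimes> B\<^esub> (c \<odot>\<^bsub>A \<boxtimes> B\<^esub> y) = c \<odot>\<^bsub>A \<boxtimes> B\<^esub> (x \<otimes>\<^bsub>A \<boxtimes> B\<^esub> y)"
    using x y by (simp_all add: mult_simps)
  assume z: "z \<in> carrier (A \<boxtimes> B)"
  show "(x \<oplus>\<^bsub>A \<boxtimes> B\<^esub> y) \<otimes>\<^bsub>A \<boxtimes> B\<^esub> z = x \<otimes>\<^bsub>A \<boxtimes> B\<^esub> z \<oplus>\<^bsub>A \<boxtimes> B\<^esub> y \<otimes>\<^bsub>A \<boxtimes> B\<^esub> z"
    "z \<otimes>\<^bsub>A \<boxtimes> B\<^esub> (x \<oplus>\<^bsub>A \<boxtimes> B\<^esub> y) = z \<otimes>\<^bsub>A \<boxtimes> B\<^esub> x \<oplus>\<^bsub>A \<boxtimes> B\<^esub> z \<otimes>\<^bsub>A \<boxtimes> B\<^esub> y"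
    using x y z by (simp_all add: mult_simps)
  have pure: "(tensor A B a b \<otimes>\<^bsub>A \<boxtimes> B\<^esub> tensor A B a' b') \<otimes>\<^bsub>A \<boxtimes> B\<^esub> z =
      tensor A B a b \<otimes>\<^bsub>A \<boxtimes> B\<^esub> (tensor A B a' b' \<otimes>\<^bsub>A \<boxtimes> B\<^esub> z)"
    if "a \<in> carrier A" "b \<in> carrier B" "a' \<in> carrier A" "b' \<in> carrier B" for a b a' b'
    using z that
    by (induction rule: tensor_induct) (simp_all add: tensor_mult A.m_assoc B.m_assoc mult_simps)
  have half: "(tensor A B a b \<otimes>\<^bsub>A \<boxtimes> B\<^esub> y) \<otimes>\<^bsub>A \<boxtimes> B\<^esub> z =
      tensor A B a b \<otimes>\<^bsub>A \<boxtimes> B\<^esub> (y \<otimes>\<^bsub>A \<boxtimes> B\<^esub> z)"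
    if "a \<in> carrier A" "b \<in> carrier B" for a b
    using y z that by (induction rule: tensor_induct) (simp_all add: pure mult_simps)
  show "(x \<otimes>\<^bsub>A \<boxtimes> B\<^esub> y) \<otimes>\<^bsub>A \<boxtimes> B\<^esub> z = x \<otimes>\<^bsub>A \<boxtimes> B\<^esub> (y \<otimes>\<^bsub>A \<boxtimes> B\<^esub> z)"
    using x y z by (induction rule: tensor_induct) (simp_all add: half mult_simps)
qed

lemma algebra_hom_tensorI:
  assumes h: "linear_map (A \<boxtimes> B) C h" and C: "complex_algebra C"
    and one: "h (tensor A B \<one>\<^bsub>A\<^esub> \<one>\<^bsub>B\<^esub>) = \<one>\<^bsub>C\<^esub>"
    and mult: "\<And>a b a' b'. \<lbrakk>a \<in> carrier A; b \<in> carrier B; a' \<in> carrier A; b' \<in> carrier B\<rbrakk> \<Longrightarrow>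
      h (tensor A B (a \<otimes>\<^bsub>A\<^esub> a') (b \<otimes>\<^bsub>B\<^esub> b')) = h (tensor A B a b) \<otimes>\<^bsub>C\<^esub> h (tensor A B a' b')"
  shows "h \<in> algebra_hom (A \<boxtimes> B) C"
proof (rule algebra_homI[OF h])
  interpret C: complex_algebra C by fact
  note hs = linear_map_simps[OF h] mult_simps
    C.l_distr C.r_distr C.smult_mult_left C.smult_mult_right
  show "h \<one>\<^bsub>A \<boxtimes> B\<^esub> = \<one>\<^bsub>C\<^esub>"
    by (simp add: one_eq one)
  have half: "h (tensor A B a b \<otimes>\<^bsub>A \<boxtimes> B\<^esub> y) = h (tensor A B a b) \<otimes>\<^bsub>C\<^esub> h y"
    if "y \<in> carrier (A \<boxtimes> B)" "a \<in> carrier A" "b \<in> carrier B" for a b y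
    using that by (induction rule: tensor_induct) (simp_all add: hs tensor_mult mult)
  show "h (x \<otimes>\<^bsub>A \<boxtimes> B\<^esub> y) = h x \<otimes>\<^bsub>C\<^esub> h y"
    if "x \<in> carrier (A \<boxtimes> B)" "y \<in> carrier (A \<boxtimes> B)" for x y
    using that by (induction rule: tensor_induct) (simp_all add: hs half)
qed

text \<open>This embedding and its mirror image produce F \<otimes> 1 and 1 \<otimes> F in the
  twisting equation and the right-hand sides of the counit axioms.\<close>

lemma algebra_hom_left: "(\<lambda>a. tensor A B a \<one>\<^bsub>B\<^esub>) \<in> algebra_hom A (A \<boxtimes> B)"
  by (rule algebra_homI[OF tensor_linear_left]) (simp_all add: tensor_mult one_eq)

lemma algebra_hom_right: "(\<lambda>b. tensor A B \<one>\<^bsub>A\<^esub> b) \<in> algebra_hom B (A \<boxtimes> B)"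
  by (rule algebra_homI[OF tensor_linear_right]) (simp_all add: tensor_mult one_eq)

lemma tensor_pow:
  assumes "a \<in> carrier A" "b \<in> carrier B"
  shows "tensor A B a b [^]\<^bsub>A \<boxtimes> B\<^esub> (n::nat) = tensor A B (a [^]\<^bsub>A\<^esub> n) (b [^]\<^bsub>B\<^esub> n)"
proof -
  interpret T: complex_algebra "A \<boxtimes> B" by (rule complex_algebra_tensor)
  show ?thesis
    using assms by (induction n) (simp_all add: one_eq tensor_mult)
qed

end

lemma tensor_algebrasI: "\<lbrakk>complex_algebra A; complex_algebra B\<rbrakk> \<Longrightarrow> tensor_algebras A B"
  by (rule tensor_algebras.intro)

lemma complex_algebra_tensor:
  "\<lbrakk>complex_algebra A; complex_algebra B\<rbrakk> \<Longrightarrow> complex_algebra (A \<boxtimes> B)"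
  by (rule tensor_algebras.complex_algebra_tensor[OF tensor_algebrasI])

section \<open>Tensor products of homomorphisms and the associator\<close>

locale tensor_homs = S: tensor_algebras A B + T: tensor_algebras C D
  for A :: "(complex, 'a, 'k) module_scheme" and B :: "(complex, 'b, 'l) module_scheme"
    and C :: "(complex, 'c, 'm) module_scheme" and D :: "(complex, 'd, 'n) module_scheme" +
  fixes f g
  assumes f: "f \<in> algebra_hom A C" and g: "g \<in> algebra_hom B D"
begin

lemma bilinear: "bilinear_map A B (C \<boxtimes> D) (\<lambda>a b. tensor C D (f a) (g b))"
  by (intro bilinear_mapI linear_mapI)
    (simp_all add: algebra_hom_simps[OF f] algebra_hom_simps[OF g] T.tensor_simps)

lemma tensor_map_tensor:
  "\<lbrakk>a \<in> carrier A; b \<in> carrier B\<rbrakk> \<Longrightarrow> tensor_map C D f g (tensor A B a b) = tensor C D (f a) (g b)"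
  unfolding tensor_map_def by (rule S.tensor_lift_tensor[OF T.T.module_axioms bilinear])

lemma tensor_map_hom: "tensor_map C D f g \<in> algebra_hom (A \<boxtimes> B) (C \<boxtimes> D)"
proof (rule S.algebra_hom_tensorI)
  show "linear_map (A \<boxtimes> B) (C \<boxtimes> D) (tensor_map C D f g)"
    unfolding tensor_map_def by (rule S.linear_map_tensor_lift[OF T.T.module_axioms bilinear])
qed (simp_all add: T.complex_algebra_tensor tensor_map_tensor T.one_eq T.tensor_mult
    algebra_hom_simps[OF f] algebra_hom_simps[OF g])

end

section \<open>The associator\<close>

locale tensor_algebras3 = A: complex_algebra A + B: complex_algebra B + C: complex_algebra C
  for A :: "(complex, 'a, 'l) module_scheme" and B :: "(complex, 'b, 'm) module_scheme"
    and C :: "(complex, 'c, 'n) module_scheme"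
begin

sublocale AB: tensor_algebras A B
  by (intro tensor_algebrasI A.complex_algebra_axioms B.complex_algebra_axioms)

sublocale BC: tensor_algebras B C
  by (intro tensor_algebrasI B.complex_algebra_axioms C.complex_algebra_axioms)

sublocale L: tensor_algebras "A \<boxtimes> B" C
  by (intro tensor_algebrasI AB.complex_algebra_tensor C.complex_algebra_axioms)

sublocale R: tensor_algebras A "B \<boxtimes> C"
  by (intro tensor_algebrasI BC.complex_algebra_tensor A.complex_algebra_axioms)

abbreviation inner_lift where
  "inner_lift c \<equiv>
    tensor_lift (A \<boxtimes> B \<boxtimes> C) (\<lambda>a b. tensor A (B \<boxtimes> C) a (tensor B C b c))"

lemma inner_bilinear:
  "c \<in> carrier C \<Longrightarrow>
    bilinear_map A B (A \<boxtimes> B \<boxtimes> C) (\<lambda>a b. tensor A (B \<boxtimes> C) a (tensor B C b c))"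
  by (intro bilinear_mapI linear_mapI) (simp_all add: R.tensor_simps BC.tensor_simps)

lemma inner_linear: "c \<in> carrier C \<Longrightarrow> linear_map (A \<boxtimes> B) (A \<boxtimes> B \<boxtimes> C) (inner_lift c)"
  by (rule AB.linear_map_tensor_lift[OF R.T.module_axioms inner_bilinear])

lemma inner_tensor:
  "\<lbrakk>a \<in> carrier A; b \<in> carrier B; c \<in> carrier C\<rbrakk> \<Longrightarrow>
    inner_lift c (tensor A B a b) = tensor A (B \<boxtimes> C) a (tensor B C b c)"
  by (rule AB.tensor_lift_tensor[OF R.T.module_axioms inner_bilinear])

text \<open>Linearity in x is that of a lift. Linearity in c, which enters as a parameter of the
  lift, has to be proved by induction on x.\<close>

lemma outer_bilinear: "bilinear_map (A \<boxtimes> B) C (A \<boxtimes> B \<boxtimes> C) (\<lambda>x c. inner_lift c x)"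
proof (rule bilinear_mapI)
  note lin = linear_map_simps[OF inner_linear]
  fix x assume x: "x \<in> carrier (A \<boxtimes> B)"
  show "linear_map C (A \<boxtimes> B \<boxtimes> C) (\<lambda>c. inner_lift c x)"
  proof (rule linear_mapI)
    fix c c' k assume c: "c \<in> carrier C"
    then show "inner_lift c x \<in> carrier (A \<boxtimes> B \<boxtimes> C)"
      using x by (simp add: lin)
    show "inner_lift (k \<odot>\<^bsub>C\<^esub> c) x = k \<odot>\<^bsub>A \<boxtimes> B \<boxtimes> C\<^esub> inner_lift c x"
      using x c
    proof (induction rule: AB.tensor_induct)
      case (smult d x)
      then show ?case
        using R.T.smult_assoc1[of k d] R.T.smult_assoc1[of d k] by (simp add: lin mult.commute)
    qed (simp_all add: lin inner_tensor R.tensor_simps BC.tensor_simps R.T.smult_r_distr)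
    assume c': "c' \<in> carrier C"
    show "inner_lift (c \<oplus>\<^bsub>C\<^esub> c') x = inner_lift c x \<oplus>\<^bsub>A \<boxtimes> B \<boxtimes> C\<^esub> inner_lift c' x"
      using x c c'
      by (induction rule: AB.tensor_induct)
        (simp_all add: lin inner_tensor R.tensor_simps BC.tensor_simps R.T.smult_r_distr R.T.M.a_ac)
  qed
qed (rule inner_linear)

lemma associator_tensor_left:
  "\<lbrakk>x \<in> carrier (A \<boxtimes> B); c \<in> carrier C\<rbrakk> \<Longrightarrow>
    associator A B C (tensor (A \<boxtimes> B) C x c) = inner_lift c x"
  unfolding associator_def by (rule L.tensor_lift_tensor[OF R.T.module_axioms outer_bilinear])

lemma associator_tensor:
  "\<lbrakk>a \<in> carrier A; b \<in> carrier B; c \<in> carrier C\<rbrakk> \<Longrightarrow>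
    associator A B C (tensor (A \<boxtimes> B) C (tensor A B a b) c) =
    tensor A (B \<boxtimes> C) a (tensor B C b c)"
  by (simp add: associator_tensor_left inner_tensor)

text \<open>Testing on pure tensors of the outer product leaves arbitrary elements x and y of
  \<open>A \<boxtimes> B\<close>, which two further inductions reduce to pure tensors.\<close>

lemma associator_hom: "associator A B C \<in> algebra_hom ((A \<boxtimes> B) \<boxtimes> C) (A \<boxtimes> B \<boxtimes> C)"
proof (rule L.algebra_hom_tensorI)
  interpret T: complex_algebra "A \<boxtimes> B \<boxtimes> C" by (rule R.complex_algebra_tensor)
  show "complex_algebra (A \<boxtimes> B \<boxtimes> C)" ..
  show "linear_map ((A \<boxtimes> B) \<boxtimes> C) (A \<boxtimes> B \<boxtimes> C) (associator A B C)"
    unfolding associator_def by (rule L.linear_map_tensor_lift[OF R.T.module_axioms outer_bilinear])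
  show "associator A B C (tensor (A \<boxtimes> B) C \<one>\<^bsub>A \<boxtimes> B\<^esub> \<one>\<^bsub>C\<^esub>) = \<one>\<^bsub>A \<boxtimes> B \<boxtimes> C\<^esub>"
    by (simp add: AB.one_eq associator_tensor R.one_eq BC.one_eq)
  note lin = linear_map_simps[OF inner_linear] AB.mult_simps
    T.l_distr T.r_distr T.smult_mult_left T.smult_mult_right
  have half: "inner_lift (c \<otimes>\<^bsub>C\<^esub> c') (tensor A B a b \<otimes>\<^bsub>A \<boxtimes> B\<^esub> y) =
      inner_lift c (tensor A B a b) \<otimes>\<^bsub>A \<boxtimes> B \<boxtimes> C\<^esub> inner_lift c' y"
    if "y \<in> carrier (A \<boxtimes> B)" "a \<in> carrier A" "b \<in> carrier B" "c \<in> carrier C" "c' \<in> carrier C"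
    for a b c c' y
    using that
    by (induction rule: AB.tensor_induct)
      (simp_all add: lin inner_tensor AB.tensor_mult BC.tensor_mult R.tensor_mult)
  have "inner_lift (c \<otimes>\<^bsub>C\<^esub> c') (x \<otimes>\<^bsub>A \<boxtimes> B\<^esub> y) =
      inner_lift c x \<otimes>\<^bsub>A \<boxtimes> B \<boxtimes> C\<^esub> inner_lift c' y"
    if "x \<in> carrier (A \<boxtimes> B)" "y \<in> carrier (A \<boxtimes> B)" "c \<in> carrier C" "c' \<in> carrier C" for x y c c'
    using that by (induction rule: AB.tensor_induct) (simp_all add: lin half)
  then show "associator A B C (tensor (A \<boxtimes> B) C (x \<otimes>\<^bsub>A \<boxtimes> B\<^esub> y) (c \<otimes>\<^bsub>C\<^esub> c')) =
      associator A B C (tensor (A \<boxtimes> B) C x c) \<otimes>\<^bsub>A \<boxtimes> B \<boxtimes> C\<^esub>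
      associator A B C (tensor (A \<boxtimes> B) C y c')"
    if "x \<in> carrier (A \<boxtimes> B)" "c \<in> carrier C" "y \<in> carrier (A \<boxtimes> B)" "c' \<in> carrier C" for x c y c'
    using that by (simp add: associator_tensor_left AB.mult_simps)
qed

end

lemma tensor_algebras3I:
  "\<lbrakk>complex_algebra A; complex_algebra B; complex_algebra C\<rbrakk> \<Longrightarrow> tensor_algebras3 A B C"
  by (rule tensor_algebras3.intro)

lemma tensor_homsI:
  "\<lbrakk>complex_algebra A; complex_algebra B; complex_algebra C; complex_algebra D;
    f \<in> algebra_hom A C; g \<in> algebra_hom B D\<rbrakk> \<Longrightarrow> tensor_homs A B C D f g"
  by (intro tensor_homs.intro tensor_homs_axioms.intro tensor_algebrasI)

section \<open>The \<open>q\<close>-binomial theorem\<close>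

text \<open>Gaussian binomials by the q-Pascal rule: the quotient of q-factorials would divide by
  zero at roots of unity.\<close>

fun q_binomial :: "complex \<Rightarrow> nat \<Rightarrow> nat \<Rightarrow> complex" where
  "q_binomial q n 0 = 1"
| "q_binomial q 0 (Suc k) = 0"
| "q_binomial q (Suc n) (Suc k) = q_binomial q n k + q ^ Suc k * q_binomial q n (Suc k)"

lemma q_binomial_eq_0: "n < k \<Longrightarrow> q_binomial q n k = 0"
  by (induction q n k rule: q_binomial.induct) auto

lemma q_binomial_self: "q_binomial q n n = 1"
  by (induction n) (simp_all add: q_binomial_eq_0)

lemma q_number_add: "q_number q (i + j) = q_number q i + q ^ i * q_number q j"
  by (induction j) (simp_all add: q_number_def power_add algebra_simps)

lemma q_fact_Suc: "q_fact q (Suc n) = q_number q (Suc n) * q_fact q n"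
  by (simp add: q_fact_def)

lemma q_fact_0 [simp]: "q_fact q 0 = 1"
  by (simp add: q_fact_def)

text \<open>The factorial formula without denominators, so it also holds where q-factorials vanish.
  The two terms of the Pascal rule contribute (i)_q and q^i (j)_q times (i+j-1)_q!, and these
  factors add up to (i+j)_q.\<close>

lemma q_binomial_q_fact: "q_binomial q (i + j) i * (q_fact q i * q_fact q j) = q_fact q (i + j)"
proof (induction "i + j" arbitrary: i j)
  case (Suc n)
  show ?case
  proof (cases i)
    case [simp]: (Suc i')
    show ?thesis
    proof (cases j)
      case 0
      then show ?thesis by (simp add: q_binomial_self)
    next
      case [simp]: (Suc j')
      have 1: "q_binomial q (i' + j) i' * (q_fact q i' * q_fact q j) = q_fact q n"
        and 2: "q_binomial q (i + j') i * (q_fact q i * q_fact q j') = q_fact q n"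
        using Suc.hyps(1)[of i' j] Suc.hyps(1)[of i j'] Suc.hyps(2) by simp_all
      have "q_binomial q (i + j) i * (q_fact q i * q_fact q j) =
          q_number q i * (q_binomial q (i' + j) i' * (q_fact q i' * q_fact q j)) +
          q ^ i * q_number q j * (q_binomial q (i + j') i * (q_fact q i * q_fact q j'))"
        by (simp add: q_fact_Suc algebra_simps)
      also have "\<dots> = q_number q (i + j) * q_fact q n"
        unfolding 1 2 q_number_add by (simp add: algebra_simps)
      also have "\<dots> = q_fact q (i + j)"
        using Suc.hyps(2) q_fact_Suc[of q n] by simp
      finally show ?thesis .
    qed
  qed simp
qed simp

text \<open>The exponents \<open>i\<close> that occur in \<open>exp\<^sub>q\<close>.\<close>

definition q_exponent :: "complex \<Rightarrow> nat \<Rightarrow> bool" where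
  "q_exponent q i \<longleftrightarrow> (\<forall>l\<ge>2. primitive_root_of_unity l q \<longrightarrow> i < l)"

lemma q_exponent_0 [simp]: "q_exponent q 0"
  by (auto simp: q_exponent_def)

lemma q_exponent_mono: "\<lbrakk>q_exponent q j; i \<le> j\<rbrakk> \<Longrightarrow> q_exponent q i"
  by (auto simp: q_exponent_def)

section \<open>The order of q and the vanishing of q-numbers\<close>

lemma q_number_geometric: "(q - 1) * q_number q k = q ^ k - 1"
  by (induction k) (simp_all add: q_number_def algebra_simps)

lemma primitive_root_exists:
  assumes "q ^ k = 1" "k > 0"
  obtains l where "primitive_root_of_unity l q" "l \<le> k"
proof -
  define l where "l = (LEAST l. l > 0 \<and> q ^ l = 1)"
  have "l > 0 \<and> q ^ l = 1" "l \<le> k"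
    unfolding l_def using assms by (auto intro: LeastI2 Least_le)
  moreover have "q ^ j \<noteq> 1" if "0 < j" "j < l" for j
    using not_less_Least[of j "\<lambda>l. l > 0 \<and> q ^ l = 1"] that unfolding l_def by auto
  ultimately show ?thesis
    by (intro that) (auto simp: primitive_root_of_unity_def)
qed

text \<open>If (k)_q = 0, then q^k = 1, so q has some order l \<le> k. Since (k)_1 = k is nonzero, q
  is not 1 and l \<ge> 2, so k is not an exponent.\<close>

lemma q_number_nonzero:
  assumes "q_exponent q k" "k > 0"
  shows "q_number q k \<noteq> 0"
proof
  assume zero: "q_number q k = 0"
  then have "q ^ k = 1"
    using q_number_geometric[of q k] by simp
  then obtain l where l: "primitive_root_of_unity l q" "l \<le> k"
    using assms(2) primitive_root_exists by blast
  have "q \<noteq> 1"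
    using zero assms(2) by (auto simp: q_number_def)
  then have "l \<ge> 2"
    using l(1) by (cases "l = 1") (auto simp: primitive_root_of_unity_def)
  with l assms(1) show False
    by (auto simp: q_exponent_def)
qed

lemma q_fact_nonzero:
  assumes "q_exponent q n"
  shows "q_fact q n \<noteq> 0"
  using assms q_exponent_mono[OF assms] q_number_nonzero by (auto simp: q_fact_def)

lemma primitive_root_of_unity_unique:
  "\<lbrakk>primitive_root_of_unity l q; primitive_root_of_unity m q\<rbrakk> \<Longrightarrow> l = m"
  unfolding primitive_root_of_unity_def by (metis linorder_neqE_nat)

lemma q_exponent_primitive_root:
  "\<lbrakk>primitive_root_of_unity l q; l \<ge> 2\<rbrakk> \<Longrightarrow> q_exponent q i \<longleftrightarrow> i < l"
  by (auto simp: q_exponent_def dest: primitive_root_of_unity_unique)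

lemma q_fact_primitive_root:
  assumes "primitive_root_of_unity l q" "l \<ge> 2"
  shows "q_fact q l = 0"
proof -
  have "q \<noteq> 1"
  proof
    assume "q = 1"
    then have "q ^ 1 = 1"
      by simp
    with assms show False
      unfolding primitive_root_of_unity_def by (metis less_le_trans one_less_numeral_iff semiring_norm(76) zero_less_one)
  qed
  then have "q_number q l = 0"
    using q_number_geometric[of q l] assms by (simp add: primitive_root_of_unity_def)
  then show ?thesis
    using assms(2) by (cases l) (simp_all add: q_fact_Suc)
qed

section \<open>q-commuting elements of an algebra\<close>

context complex_algebra
begin

lemma smult_smult: "x \<in> carrier A \<Longrightarrow> c \<odot> (d \<odot> x) = (c * d) \<odot> x"
  using smult_assoc1[of c d x] by simp

lemma smult_add: "x \<in> carrier A \<Longrightarrow> (c + d) \<odot> x = c \<odot> x \<oplus> d \<odot> x"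
  using smult_l_distr[of c d x] by simp

lemma one_smult: "x \<in> carrier A \<Longrightarrow> 1 \<odot> x = x"
  using smult_one[of x] by simp

lemma zero_smult: "x \<in> carrier A \<Longrightarrow> 0 \<odot> x = \<zero>"
  using smult_l_null[of x] by simp

context
  fixes x y q
  assumes x: "x \<in> carrier A" and y: "y \<in> carrier A" and q_comm: "y \<otimes> x = q \<odot> (x \<otimes> y)"
begin

lemma q_comm_pow: "y \<otimes> x [^] (i::nat) = (q ^ i) \<odot> (x [^] i \<otimes> y)"
proof (induction i)
  case (Suc i)
  have "y \<otimes> x [^] Suc i = (y \<otimes> x [^] i) \<otimes> x"
    using x y by (simp add: m_assoc)
  also have "\<dots> = (q ^ i) \<odot> (x [^] i \<otimes> (y \<otimes> x))"
    using x y by (simp add: Suc smult_mult_left m_assoc)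
  also have "\<dots> = (q ^ Suc i) \<odot> (x [^] Suc i \<otimes> y)"
    using x y by (simp add: q_comm smult_mult_right smult_smult m_assoc mult.commute)
  finally show ?case .
qed (use y in \<open>simp add: one_smult\<close>)

text \<open>The new factor x + y is multiplied on from the left: moving y past x^i costs q^i, which
  is the weight in the Pascal rule.\<close>

lemma q_binomial_theorem:
  "(x \<oplus> y) [^] n = (\<Oplus>i\<in>{..n}. q_binomial q n i \<odot> (x [^] i \<otimes> y [^] (n - i)))"
proof (induction n)
  case 0
  show ?case
    by (simp add: one_smult)
next
  case (Suc n)
  define M where "M i = x [^] i \<otimes> y [^] (Suc n - i)" for i
  \<comment> \<open>\<open>a i\<close> and \<open>b i\<close> are the coefficients of
    \<open>M i\<close> contributed by x and by y. Both sums extend to {..Suc n}, because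
    \<open>a 0\<close> and \<open>b (Suc n)\<close> vanish.\<close>
  define a where "a i = (case i of 0 \<Rightarrow> 0 | Suc k \<Rightarrow> q_binomial q n k)" for i
  define b where "b i = q ^ i * q_binomial q n i" for i
  have M: "M i \<in> carrier A" for i
    using x y by (simp add: M_def)
  have closed: "q_binomial q n i \<odot> (x [^] i \<otimes> y [^] (n - i)) \<in> carrier A" for i
    using x y by simp
  have "(x \<oplus> y) [^] Suc n = (x \<oplus> y) \<otimes> (x \<oplus> y) [^] n"
    using x y by (intro nat_pow_Suc2) simp
  also have "\<dots> =
      (\<Oplus>i\<in>{..n}. x \<otimes> (q_binomial q n i \<odot> (x [^] i \<otimes> y [^] (n - i)))) \<oplus>
      (\<Oplus>i\<in>{..n}. y \<otimes> (q_binomial q n i \<odot> (x [^] i \<otimes> y [^] (n - i))))"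
    unfolding Suc using x y closed by (simp add: l_distr finsum_rdistr)
  also have "(\<Oplus>i\<in>{..n}. x \<otimes> (q_binomial q n i \<odot> (x [^] i \<otimes> y [^] (n - i)))) =
      (\<Oplus>i\<in>{..n}. a (Suc i) \<odot> M (Suc i))"
  proof (rule finsum_cong')
    fix i
    have "x \<otimes> (x [^] i \<otimes> y [^] (n - i)) = x [^] Suc i \<otimes> y [^] (n - i)"
      using x y by (simp only: nat_pow_Suc2 m_assoc nat_pow_closed)
    then show "x \<otimes> (q_binomial q n i \<odot> (x [^] i \<otimes> y [^] (n - i))) = a (Suc i) \<odot> M (Suc i)"
      using x y by (simp add: a_def M_def smult_mult_right)
  qed (use M in auto)
  also have "\<dots> = (\<Oplus>i\<in>{..Suc n}. a i \<odot> M i)"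
    using M by (subst finsum_Suc2) (auto simp: a_def[of 0] zero_smult)
  also have "(\<Oplus>i\<in>{..n}. y \<otimes> (q_binomial q n i \<odot> (x [^] i \<otimes> y [^] (n - i)))) =
      (\<Oplus>i\<in>{..n}. b i \<odot> M i)"
  proof (rule finsum_cong')
    fix i assume i: "i \<in> {..n}"
    have "y \<otimes> (x [^] i \<otimes> y [^] (n - i)) = (y \<otimes> x [^] i) \<otimes> y [^] (n - i)"
      using x y by (simp add: m_assoc)
    also have "\<dots> = (q ^ i) \<odot> (x [^] i \<otimes> (y \<otimes> y [^] (n - i)))"
      using x y by (simp add: q_comm_pow smult_mult_left m_assoc)
    also have "y \<otimes> y [^] (n - i) = y [^] (Suc n - i)"
      using y i by (simp add: Suc_diff_le nat_pow_Suc2[symmetric] del: nat_pow_Suc)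
    finally show "y \<otimes> (q_binomial q n i \<odot> (x [^] i \<otimes> y [^] (n - i))) = b i \<odot> M i"
      using x y by (simp add: b_def M_def smult_mult_right smult_smult mult.commute)
  qed (use M in auto)
  also have "\<dots> = (\<Oplus>i\<in>{..Suc n}. b i \<odot> M i)"
    using M by (subst finsum_Suc) (auto simp: b_def[of "Suc n"] q_binomial_eq_0 zero_smult)
  also have "(\<Oplus>i\<in>{..Suc n}. a i \<odot> M i) \<oplus> (\<Oplus>i\<in>{..Suc n}. b i \<odot> M i) =
      (\<Oplus>i\<in>{..Suc n}. a i \<odot> M i \<oplus> b i \<odot> M i)"
    using M by (subst finsum_addf) auto
  also have "\<dots> = (\<Oplus>i\<in>{..Suc n}. q_binomial q (Suc n) i \<odot> M i)"
  proof (rule finsum_cong')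
    fix i
    show "a i \<odot> M i \<oplus> b i \<odot> M i = q_binomial q (Suc n) i \<odot> M i"
      using M[of i] by (cases i) (simp_all add: a_def b_def smult_add zero_smult)
  qed (use M in auto)
  finally show ?case
    by (simp add: M_def)
qed

text \<open>By the q-binomial theorem (x + y)^l = x^l + y^l, since the inner coefficients vanish.
  Applied to the two summands of \<Delta>(D_i), it lets the comultiplication pass to the
  quotient.\<close>

lemma nilpotent_add:
  assumes l: "primitive_root_of_unity l q" "l \<ge> 2" and "x [^] l = \<zero>" "y [^] l = \<zero>"
  shows "(x \<oplus> y) [^] l = \<zero>"
proof -
  have "q_binomial q l i \<odot> (x [^] i \<otimes> y [^] (l - i)) = \<zero>" if i: "i \<le> l" for i
  proof (cases "i = 0 \<or> i = l")
    case True
    then show ?thesis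
      using x y assms smult_r_null by auto
  next
    case False
    \<comment> \<open>For 0 < i < l the q-factorials of i and l - i are nonzero while that of l is
      0, which forces the binomial to be 0.\<close>
    then have "q_fact q i * q_fact q (l - i) \<noteq> 0"
      using i by (simp add: q_fact_nonzero q_exponent_primitive_root[OF l])
    then have "q_binomial q l i = 0"
      using q_binomial_q_fact[of q i "l - i"] i by (simp add: q_fact_primitive_root[OF l])
    then show ?thesis
      using x y by (simp add: zero_smult)
  qed
  then show ?thesis
    unfolding q_binomial_theorem by (intro add.finprod_one_eqI) simp
qed

end

end

section \<open>Divided powers and the \<open>q\<close>-exponential\<close>

text \<open>The coefficient of t^n in exp_q(t x), with the truncation built in as a zero
  scalar.\<close>

definition divided_power ::
    "(complex, 'a, 'm) module_scheme \<Rightarrow> complex \<Rightarrow> nat \<Rightarrow> 'a \<Rightarrow> 'a" where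
  "divided_power A q n x = (if q_exponent q n then 1 / q_fact q n else 0) \<odot>\<^bsub>A\<^esub> x [^]\<^bsub>A\<^esub> n"

lemma algebra_hom_divided_power:
  assumes "h \<in> algebra_hom A B" "complex_algebra A" "complex_algebra B" "x \<in> carrier A"
  shows "h (divided_power A q n x) = divided_power B q n (h x)"
proof -
  interpret A: complex_algebra A by fact
  interpret B: complex_algebra B by fact
  show ?thesis
    using assms(4)
    by (simp add: divided_power_def algebra_hom_simps[OF assms(1)]
        algebra_hom_pow[OF assms(1) A.ring_axioms B.ring_axioms])
qed

context complex_algebra
begin

lemma divided_power_closed [simp]: "x \<in> carrier A \<Longrightarrow> divided_power A q n x \<in> carrier A"
  by (simp add: divided_power_def)

lemma divided_power_0: "divided_power A q 0 x = \<one>"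
  by (simp add: divided_power_def one_smult)

lemma divided_power_zero: "n > 0 \<Longrightarrow> divided_power A q n \<zero> = \<zero>"
  using smult_r_null by (simp add: divided_power_def nat_pow_zero)

text \<open>For an exponent n this is the q-binomial theorem divided by (n)_q!. Otherwise the left
  side is cut off, and \<open>null\<close> makes every summand on the right vanish, including those
  with both i and n - i in the allowed range.\<close>

lemma divided_power_add:
  assumes x: "x \<in> carrier A" and y: "y \<in> carrier A" and q_comm: "y \<otimes> x = q \<odot> (x \<otimes> y)"
    and null: "\<And>i j. \<not> q_exponent q (i + j) \<Longrightarrow> x [^] i \<otimes> y [^] j = \<zero>"
  shows "divided_power A q n (x \<oplus> y) =
    (\<Oplus>i\<in>{..n}. divided_power A q i x \<otimes> divided_power A q (n - i) y)"
proof (cases "q_exponent q n")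
  case True
  have "divided_power A q n (x \<oplus> y) =
      (\<Oplus>i\<in>{..n}. (1 / q_fact q n) \<odot> (q_binomial q n i \<odot> (x [^] i \<otimes> y [^] (n - i))))"
    using True x y
    by (simp add: divided_power_def q_binomial_theorem[OF x y q_comm] finsum_smult_ldistr)
  also have "\<dots> = (\<Oplus>i\<in>{..n}. divided_power A q i x \<otimes> divided_power A q (n - i) y)"
  proof (rule finsum_cong')
    fix i assume i: "i \<in> {..n}"
    have nz: "q_fact q n \<noteq> 0" "q_fact q i \<noteq> 0" "q_fact q (n - i) \<noteq> 0"
      using i q_exponent_mono[OF True] by (auto intro!: q_fact_nonzero)
    have "1 / q_fact q n * q_binomial q n i = 1 / q_fact q i * (1 / q_fact q (n - i))"
      using q_binomial_q_fact[of q i "n - i"] i nz by (simp add: field_simps)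
    then show "(1 / q_fact q n) \<odot> (q_binomial q n i \<odot> (x [^] i \<otimes> y [^] (n - i))) =
        divided_power A q i x \<otimes> divided_power A q (n - i) y"
      using x y i q_exponent_mono[OF True]
      by (simp add: divided_power_def smult_smult smult_mult_left smult_mult_right mult.commute)
  qed (use x y in auto)
  finally show ?thesis .
next
  case False
  have "divided_power A q i x \<otimes> divided_power A q (n - i) y = \<zero>" if "i \<le> n" for i
    using that x y null[of i "n - i"] False smult_r_null
    by (simp add: divided_power_def smult_smult smult_mult_left smult_mult_right)
  then have "(\<Oplus>i\<in>{..n}. divided_power A q i x \<otimes> divided_power A q (n - i) y) = \<zero>"
    by (intro add.finprod_one_eqI) simp
  with False x y show ?thesis
    by (simp add: divided_power_def zero_smult)
qed

lemma pow_comm: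
  assumes "x \<in> carrier A" "y \<in> carrier A" "x \<otimes> y = y \<otimes> x"
  shows "x [^] (i::nat) \<otimes> y [^] (j::nat) = y [^] j \<otimes> x [^] i"
  using group_commutes_pow[OF group_commutes_pow[OF assms(3,1,2), symmetric], of i j] assms(1,2)
  by simp

lemma t_times_pow:
  assumes x: "x \<in> carrier A"
  shows "(t_times A x [^]\<^bsub>power_series A\<^esub> (i::nat)) n = (if n = i then x [^] i else \<zero>)"
proof (induction i arbitrary: n)
  case 0
  show ?case
    by (simp add: nat_pow_def power_series_def)
next
  case (Suc i)
  let ?f = "\<lambda>k. (if k = i then x [^] i else \<zero>) \<otimes> t_times A x (n - k)"
  have t: "t_times A x k \<in> carrier A" for k
    using x by (simp add: t_times_def)
  have "(t_times A x [^]\<^bsub>power_series A\<^esub> Suc i) n = finsum A ?f {..n}"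
    using Suc by (simp add: nat_pow_def power_series_def)
  \<comment> \<open>Only k = i survives, and the remaining factor has its single nonzero coefficient
    at n - k = 1.\<close>
  also have "\<dots> = (\<Oplus>k\<in>{..n}. if i = k then (if n = Suc i then x [^] Suc i else \<zero>) else \<zero>)"
    using x t by (intro finsum_cong') (auto simp: t_times_def)
  also have "\<dots> = (if n = Suc i then x [^] Suc i else \<zero>)"
  proof (cases "n = Suc i")
    case True
    then show ?thesis
      using x finsum_singleton[of i "{..n}" "\<lambda>_. x [^] Suc i"] by simp
  next
    case False
    then show ?thesis
      by simp
  qed
  finally show ?case .
qed

text \<open>(t x)^i is concentrated in degree i, so the index set in \<open>q_exp\<close> is empty
  or {n}. It is empty exactly when n is no exponent or x^n = 0, and then the divided power vanishes
  as well.\<close>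

lemma q_exp_t_times:
  assumes x: "x \<in> carrier A"
  shows "q_exp A q (t_times A x) = (\<lambda>n. divided_power A q n x)"
proof
  fix n
  have set_eq: "{i. (\<forall>l\<ge>2. primitive_root_of_unity l q \<longrightarrow> i < l) \<and>
      (if n = i then x [^] i else \<zero>) \<noteq> \<zero>} = (if q_exponent q n \<and> x [^] n \<noteq> \<zero> then {n} else {})"
    by (auto simp: q_exponent_def)
  show "q_exp A q (t_times A x) n = divided_power A q n x"
    unfolding q_exp_def t_times_pow[OF x] set_eq
    using x smult_r_null by (auto simp: divided_power_def zero_smult)
qed

text \<open>The substitution i = a + j on the triangle a \<le> i \<le> n; the induction step adds
  the terms with i = n + 1.\<close>

lemma finsum_triangle:
  assumes "\<And>a i. f a i \<in> carrier A"
  shows "(\<Oplus>i\<in>{..n::nat}. \<Oplus>a\<in>{..i}. f a i) = (\<Oplus>a\<in>{..n}. \<Oplus>j\<in>{..n - a}. f a (a + j))"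
proof (induction n)
  case (Suc n)
  have fin: "(\<Oplus>a\<in>I. g a) \<in> carrier A" if "\<And>a. g a \<in> carrier A" for I :: "nat set" and g
    using that by (simp add: finsum_closed)
  have "(\<Oplus>a\<in>{..Suc n}. \<Oplus>j\<in>{..Suc n - a}. f a (a + j)) =
      f (Suc n) (Suc n) \<oplus> (\<Oplus>a\<in>{..n}. \<Oplus>j\<in>{..Suc n - a}. f a (a + j))"
    using assms fin by simp
  also have "(\<Oplus>a\<in>{..n}. \<Oplus>j\<in>{..Suc n - a}. f a (a + j)) =
      (\<Oplus>a\<in>{..n}. f a (Suc n) \<oplus> (\<Oplus>j\<in>{..n - a}. f a (a + j)))"
    using assms fin by (intro finsum_cong') (auto simp: Suc_diff_le)
  also have "\<dots> = (\<Oplus>a\<in>{..n}. f a (Suc n)) \<oplus> (\<Oplus>a\<in>{..n}. \<Oplus>j\<in>{..n - a}. f a (a + j))"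
    using assms fin by (intro finsum_addf) auto
  finally show ?case
    using assms fin Suc by (simp add: a_assoc)
qed (use assms in simp)

lemma finsum_reverse:
  assumes "\<And>j. f j \<in> carrier A"
  shows "(\<Oplus>j\<in>{..m::nat}. f (m - j)) = (\<Oplus>j\<in>{..m}. f j)"
proof -
  have "k \<in> (\<lambda>j. m - j) ` {..m}" if "k \<le> m" for k
    using that by (intro image_eqI[of _ _ "m - k"]) auto
  then have "(\<lambda>j. m - j) ` {..m} = {..m}"
    by auto
  moreover have "inj_on (\<lambda>j. m - j) {..m}"
    by (auto simp: inj_on_def)
  ultimately show ?thesis
    using finsum_reindex[of f "\<lambda>j. m - j" "{..m}"] assms by auto
qed

text \<open>In terms of power series, \<open>exp\<^sub>q(t(x + y)) exp\<^sub>q(t z) = exp\<^sub>q(t x) exp\<^sub>q(t y) exp\<^sub>q(t z)\<close> is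
  symmetric in \<open>y\<close> and \<open>z\<close>.\<close>

lemma divided_power_exchange:
  assumes x: "x \<in> carrier A" and y: "y \<in> carrier A" and z: "z \<in> carrier A"
    and yx: "y \<otimes> x = q \<odot> (x \<otimes> y)" and zx: "z \<otimes> x = q \<odot> (x \<otimes> z)" and yz: "y \<otimes> z = z \<otimes> y"
    and xy_null: "\<And>i j. \<not> q_exponent q (i + j) \<Longrightarrow> x [^] i \<otimes> y [^] j = \<zero>"
    and xz_null: "\<And>i j. \<not> q_exponent q (i + j) \<Longrightarrow> x [^] i \<otimes> z [^] j = \<zero>"
  shows "(\<Oplus>i\<in>{..n}. divided_power A q i (x \<oplus> y) \<otimes> divided_power A q (n - i) z) =
    (\<Oplus>i\<in>{..n}. divided_power A q i (x \<oplus> z) \<otimes> divided_power A q (n - i) y)"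
proof -
  let ?e = "divided_power A q"
  \<comment> \<open>Stated for general v and w, because it is used both for (y, z) and for (z,
    y).\<close>
  have expand: "(\<Oplus>i\<in>{..n}. ?e i (x \<oplus> v) \<otimes> ?e (n - i) w) =
      (\<Oplus>a\<in>{..n}. \<Oplus>j\<in>{..n - a}. ?e a x \<otimes> (?e j v \<otimes> ?e (n - a - j) w))"
    if v: "v \<in> carrier A" and w: "w \<in> carrier A" and vx: "v \<otimes> x = q \<odot> (x \<otimes> v)"
      and null: "\<And>i j. \<not> q_exponent q (i + j) \<Longrightarrow> x [^] i \<otimes> v [^] j = \<zero>" for v w
  proof -
    have "(\<Oplus>i\<in>{..n}. ?e i (x \<oplus> v) \<otimes> ?e (n - i) w) =
        (\<Oplus>i\<in>{..n}. \<Oplus>a\<in>{..i}. ?e a x \<otimes> (?e (i - a) v \<otimes> ?e (n - i) w))"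
      using x v w
      by (intro finsum_cong') (auto simp: divided_power_add[OF x v vx null] finsum_ldistr m_assoc)
    also have "\<dots> = (\<Oplus>a\<in>{..n}. \<Oplus>j\<in>{..n - a}. ?e a x \<otimes> (?e (a + j - a) v \<otimes> ?e (n - (a + j)) w))"
      using x v w by (intro finsum_triangle) simp
    finally show ?thesis
      by simp
  qed
  have comm: "?e i y \<otimes> ?e j z = ?e j z \<otimes> ?e i y" for i j
    using y z pow_comm[OF y z yz, of i j]
    by (simp add: divided_power_def smult_mult_left smult_mult_right smult_smult mult.commute)
  have "(\<Oplus>j\<in>{..m}. ?e a x \<otimes> (?e j y \<otimes> ?e (m - j) z)) =
      (\<Oplus>j\<in>{..m}. ?e a x \<otimes> (?e j z \<otimes> ?e (m - j) y))" for a m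
  proof -
    \<comment> \<open>Replacing j by m - j exchanges the two degrees; \<open>comm\<close> then
      exchanges the two factors.\<close>
    have "(\<Oplus>j\<in>{..m}. ?e a x \<otimes> (?e j y \<otimes> ?e (m - j) z)) =
        (\<Oplus>j\<in>{..m}. ?e a x \<otimes> (?e (m - j) y \<otimes> ?e (m - (m - j)) z))"
      using x y z by (intro finsum_reverse[symmetric]) simp
    also have "\<dots> = (\<Oplus>j\<in>{..m}. ?e a x \<otimes> (?e j z \<otimes> ?e (m - j) y))"
      using x y z by (intro finsum_cong') (auto simp: comm)
    finally show ?thesis .
  qed
  moreover have "(\<Oplus>i\<in>{..n}. ?e i (x \<oplus> y) \<otimes> ?e (n - i) z) =
      (\<Oplus>a\<in>{..n}. \<Oplus>j\<in>{..n - a}. ?e a x \<otimes> (?e j y \<otimes> ?e (n - a - j) z))"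
    by (rule expand[OF y z yx]) (rule xy_null)
  moreover have "(\<Oplus>i\<in>{..n}. ?e i (x \<oplus> z) \<otimes> ?e (n - i) y) =
      (\<Oplus>a\<in>{..n}. \<Oplus>j\<in>{..n - a}. ?e a x \<otimes> (?e j z \<otimes> ?e (n - a - j) y))"
    by (rule expand[OF z y zx]) (rule xz_null)
  ultimately show ?thesis
    by (simp only:)
qed

end

section \<open>The deformation formula\<close>

lemma scalars_simps [simp]:
  "carrier scalars = UNIV" "\<one>\<^bsub>scalars\<^esub> = 1" "\<zero>\<^bsub>scalars\<^esub> = 0"
  "x \<otimes>\<^bsub>scalars\<^esub> y = x * y" "x \<oplus>\<^bsub>scalars\<^esub> y = x + y" "c \<odot>\<^bsub>scalars\<^esub> x = c * x"
  by (simp_all add: scalars_def)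

lemma complex_algebra_scalars: "complex_algebra scalars"
  by (intro complex_algebraI complex_moduleI) (simp_all add: algebra_simps)

text \<open>
  An abstract version of \<open>H\<^sub>q\<close>.  The relations \<open>D\<^sub>i\<^sup>n = 0\<close> for all \<open>n\<close> that do not occur as exponents
  in \<open>exp\<^sub>q\<close> are vacuous unless \<open>q\<close> is a root of unity of order \<open>l \<ge> 2\<close>.
\<close>

locale skew_bialgebra = complex_algebra B for B :: "('a, 'm) bialg_scheme" (structure) +
  fixes q d1 d2 s s'
  assumes gens_closed: "d1 \<in> carrier B" "d2 \<in> carrier B" "s \<in> carrier B" "s' \<in> carrier B"
    and gens_generate: "generates B {d1, d2, s, s'}"
    and d1_d2: "d1 \<otimes> d2 = d2 \<otimes> d1"
    and d1_s: "d1 \<otimes> s = q \<odot> (s \<otimes> d1)"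
    and d2_s: "d2 \<otimes> s = q \<odot> (s \<otimes> d2)"
    and d1_pow: "\<not> q_exponent q n \<Longrightarrow> d1 [^] n = \<zero>"
    and d2_pow: "\<not> q_exponent q n \<Longrightarrow> d2 [^] n = \<zero>"
    and \<Delta>: "comult B \<in> algebra_hom B (B \<boxtimes> B)"
    and \<epsilon>: "counit B \<in> algebra_hom B scalars"
    and \<Delta>_d1: "comult B d1 = tensor B B d1 s \<oplus>\<^bsub>B \<boxtimes> B\<^esub> tensor B B \<one> d1"
    and \<Delta>_d2: "comult B d2 = tensor B B d2 \<one> \<oplus>\<^bsub>B \<boxtimes> B\<^esub> tensor B B s d2"
    and \<Delta>_s: "comult B s = tensor B B s s"
    and \<Delta>_s': "comult B s' = tensor B B s' s'"
    and \<epsilon>_gens: "counit B d1 = 0" "counit B d2 = 0" "counit B s = 1" "counit B s' = 1"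
begin

sublocale BBB: tensor_algebras3 B B B
  by (intro tensor_algebras3I complex_algebra_axioms)

lemmas BB_algebra = BBB.AB.complex_algebra_tensor
lemmas BBB_algebra = BBB.R.complex_algebra_tensor

sublocale \<Delta>id: tensor_homs B B "B \<boxtimes> B" B "comult B" id
  by (intro tensor_homsI complex_algebra_axioms BB_algebra \<Delta> algebra_hom_id)

sublocale id\<Delta>: tensor_homs B B B "B \<boxtimes> B" id "comult B"
  by (intro tensor_homsI complex_algebra_axioms BB_algebra \<Delta> algebra_hom_id)

sublocale \<epsilon>id: tensor_homs B B scalars B "counit B" id
  by (intro tensor_homsI complex_algebra_axioms complex_algebra_scalars \<epsilon> algebra_hom_id)

sublocale id\<epsilon>: tensor_homs B B B scalars id "counit B"
  by (intro tensor_homsI complex_algebra_axioms complex_algebra_scalars \<epsilon> algebra_hom_id)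

lemma hom_eqI:
  assumes "g \<in> algebra_hom B C" "h \<in> algebra_hom B C" "x \<in> carrier B"
    "g d1 = h d1" "g d2 = h d2" "g s = h s" "g s' = h s'"
  shows "g x = h x"
  by (rule algebra_hom_eqI[OF gens_generate _ complex_algebra_axioms assms(1,2) _ assms(3)])
    (use assms gens_closed in auto)

lemmas left_\<Delta> = algebra_hom_comp[OF \<Delta>id.tensor_map_hom BBB.associator_hom]

text \<open>Both sides are homomorphisms in x, so four values suffice. Both give d1 \<otimes> s
  \<otimes> s + 1 \<otimes> d1 \<otimes> s + 1 \<otimes> 1 \<otimes> d1 on d1, and d2 \<otimes> 1
  \<otimes> 1 + s \<otimes> d2 \<otimes> 1 + s \<otimes> s \<otimes> d2 on d2.\<close>

lemma coassociative:
  assumes "x \<in> carrier B"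
  shows "associator B B B (tensor_map (B \<boxtimes> B) B (comult B) id (comult B x)) =
    tensor_map B (B \<boxtimes> B) id (comult B) (comult B x)"
proof (rule hom_eqI[OF algebra_hom_comp[OF \<Delta> left_\<Delta>]
      algebra_hom_comp[OF \<Delta> id\<Delta>.tensor_map_hom] assms])
qed (simp_all add: \<Delta>_d1 \<Delta>_d2 \<Delta>_s \<Delta>_s' gens_closed algebra_hom_simps[OF left_\<Delta>]
    algebra_hom_simps[OF id\<Delta>.tensor_map_hom] algebra_hom_simps[OF \<Delta>id.tensor_map_hom]
    algebra_hom_simps[OF BBB.associator_hom] algebra_hom_one[OF \<Delta>]
    \<Delta>id.tensor_map_tensor id\<Delta>.tensor_map_tensor BBB.associator_tensor
    BBB.L.tensor_simps BBB.R.tensor_simps BBB.AB.one_eq BBB.R.T.M.a_assoc)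

lemma counital:
  assumes "x \<in> carrier B"
  shows "tensor_map scalars B (counit B) id (comult B x) = tensor scalars B 1 x"
    and "tensor_map B scalars id (counit B) (comult B x) = tensor B scalars x 1"
proof -
  show "tensor_map scalars B (counit B) id (comult B x) = tensor scalars B 1 x"
    by (rule hom_eqI[OF algebra_hom_comp[OF \<Delta> \<epsilon>id.tensor_map_hom]
          \<epsilon>id.T.algebra_hom_right[simplified] assms])
      (use \<epsilon>id.T.tensor_zero_left in \<open>simp_all add: \<Delta>_d1 \<Delta>_d2 \<Delta>_s \<Delta>_s' \<epsilon>_gens gens_closed
        algebra_hom_simps[OF \<epsilon>id.tensor_map_hom] algebra_hom_one[OF \<epsilon>] \<epsilon>id.tensor_map_tensor\<close>)
  show "tensor_map B scalars id (counit B) (comult B x) = tensor B scalars x 1"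
    by (rule hom_eqI[OF algebra_hom_comp[OF \<Delta> id\<epsilon>.tensor_map_hom]
          id\<epsilon>.T.algebra_hom_left[simplified] assms])
      (use id\<epsilon>.T.tensor_zero_right in \<open>simp_all add: \<Delta>_d1 \<Delta>_d2 \<Delta>_s \<Delta>_s' \<epsilon>_gens gens_closed
        algebra_hom_simps[OF id\<epsilon>.tensor_map_hom] algebra_hom_one[OF \<epsilon>] id\<epsilon>.tensor_map_tensor\<close>)
qed

lemma bialgebra: "bialgebra B"
  by (intro bialgebra.intro bialgebra_axioms.intro complex_algebra_axioms \<Delta> \<epsilon> coassociative
      counital)

section \<open>The twisting equation\<close>

abbreviation \<xi> where "\<xi> \<equiv> tensor B (B \<boxtimes> B) d1 (tensor B B s d2)"
abbreviation \<eta> where "\<eta> \<equiv> tensor B (B \<boxtimes> B) \<one> (tensor B B d1 d2)"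
abbreviation \<zeta> where "\<zeta> \<equiv> tensor B (B \<boxtimes> B) d1 (tensor B B d2 \<one>)"
abbreviation w where "w \<equiv> tensor B B d1 d2"

text \<open>Everything happens in the middle leg, where the relations are d1 s = q s d1, d2 s = q s
  d2 and d1 d2 = d2 d1 respectively.\<close>

lemma \<xi>_\<eta>_\<zeta>_relations:
  "\<eta> \<otimes>\<^bsub>B \<boxtimes> B \<boxtimes> B\<^esub> \<xi> = q \<odot>\<^bsub>B \<boxtimes> B \<boxtimes> B\<^esub> (\<xi> \<otimes>\<^bsub>B \<boxtimes> B \<boxtimes> B\<^esub> \<eta>)"
  "\<zeta> \<otimes>\<^bsub>B \<boxtimes> B \<boxtimes> B\<^esub> \<xi> = q \<odot>\<^bsub>B \<boxtimes> B \<boxtimes> B\<^esub> (\<xi> \<otimes>\<^bsub>B \<boxtimes> B \<boxtimes> B\<^esub> \<zeta>)"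
  "\<eta> \<otimes>\<^bsub>B \<boxtimes> B \<boxtimes> B\<^esub> \<zeta> = \<zeta> \<otimes>\<^bsub>B \<boxtimes> B \<boxtimes> B\<^esub> \<eta>"
  by (simp_all add: gens_closed BBB.R.tensor_mult BBB.AB.tensor_mult d1_s d2_s d1_d2
      BBB.R.tensor_simps BBB.AB.tensor_simps)

text \<open>The third leg of the product is d2^(i+j). For \<xi> and \<zeta> below, the first leg is
  d1^(i+j).\<close>

lemma \<xi>_\<eta>_null:
  assumes "\<not> q_exponent q (i + j)"
  shows "\<xi> [^]\<^bsub>B \<boxtimes> B \<boxtimes> B\<^esub> i \<otimes>\<^bsub>B \<boxtimes> B \<boxtimes> B\<^esub> \<eta> [^]\<^bsub>B \<boxtimes> B \<boxtimes> B\<^esub> j = \<zero>\<^bsub>B \<boxtimes> B \<boxtimes> B\<^esub>"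
  using d2_pow[OF assms]
  by (simp add: gens_closed BBB.R.tensor_pow BBB.AB.tensor_pow BBB.R.tensor_mult
      BBB.AB.tensor_mult nat_pow_mult BBB.R.tensor_simps BBB.AB.tensor_simps)

lemma \<xi>_\<zeta>_null:
  assumes "\<not> q_exponent q (i + j)"
  shows "\<xi> [^]\<^bsub>B \<boxtimes> B \<boxtimes> B\<^esub> i \<otimes>\<^bsub>B \<boxtimes> B \<boxtimes> B\<^esub> \<zeta> [^]\<^bsub>B \<boxtimes> B \<boxtimes> B\<^esub> j = \<zero>\<^bsub>B \<boxtimes> B \<boxtimes> B\<^esub>"
  using d1_pow[OF assms]
  by (simp add: gens_closed BBB.R.tensor_pow BBB.R.tensor_mult nat_pow_mult BBB.R.tensor_simps)

lemma universal_deformation_formula_q_exp: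
  "universal_deformation_formula B (q_exp (B \<boxtimes> B) q (t_times (B \<boxtimes> B) w))"
proof -
  interpret T: complex_algebra "B \<boxtimes> B \<boxtimes> B" by (rule BBB_algebra)
  interpret L: complex_algebra "(B \<boxtimes> B) \<boxtimes> B" by (rule BBB.L.complex_algebra_tensor)
  interpret SB: complex_algebra "scalars \<boxtimes> B" by (rule \<epsilon>id.T.complex_algebra_tensor)
  interpret BS: complex_algebra "B \<boxtimes> scalars" by (rule id\<epsilon>.T.complex_algebra_tensor)
  have w: "w \<in> carrier (B \<boxtimes> B)"
    by (simp add: gens_closed)
  define F where "F n = divided_power (B \<boxtimes> B) q n w" for n
  have F: "F n \<in> carrier (B \<boxtimes> B)" for n
    using w by (simp add: F_def)
  have F_eq: "q_exp (B \<boxtimes> B) q (t_times (B \<boxtimes> B) w) = F"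
    using BBB.L.A.q_exp_t_times[OF w] by (simp add: F_def[abs_def])
  \<comment> \<open>Every map applied to F is an algebra homomorphism, so each coefficient of the
    image is a divided power of the image of w.\<close>
  note dp = algebra_hom_divided_power[OF _ BB_algebra _ w]
  have "tensor_map scalars B (counit B) id (F n) = \<one>\<^bsub>power_series (scalars \<boxtimes> B)\<^esub> n" for n
    \<comment> \<open>Since \<epsilon>(d1) = 0, the image of w is 0, and the divided powers of 0 are
      1 in degree 0 and 0 in positive degree.\<close>
    using \<epsilon>id.T.tensor_zero_left[of d2] unfolding F_def
    by (simp add: dp[OF \<epsilon>id.tensor_map_hom SB.complex_algebra_axioms] \<epsilon>id.tensor_map_tensor gens_closed
        \<epsilon>_gens SB.divided_power_0 SB.divided_power_zero power_series_def)
  moreover have "tensor_map B scalars id (counit B) (F n) = \<one>\<^bsub>power_series (B \<boxtimes> scalars)\<^esub> n" for n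
    using id\<epsilon>.T.tensor_zero_right[of d1] unfolding F_def
    by (simp add: dp[OF id\<epsilon>.tensor_map_hom BS.complex_algebra_axioms] id\<epsilon>.tensor_map_tensor gens_closed
        \<epsilon>_gens BS.divided_power_0 BS.divided_power_zero power_series_def)
  moreover have "associator B B B
        (\<Oplus>\<^bsub>(B \<boxtimes> B) \<boxtimes> B\<^esub>i\<in>{..n}. tensor_map (B \<boxtimes> B) B (comult B) id (F i)
          \<otimes>\<^bsub>(B \<boxtimes> B) \<boxtimes> B\<^esub> tensor (B \<boxtimes> B) B (F (n - i)) \<one>) =
      (\<Oplus>\<^bsub>B \<boxtimes> B \<boxtimes> B\<^esub>i\<in>{..n}. tensor_map B (B \<boxtimes> B) id (comult B) (F i)
          \<otimes>\<^bsub>B \<boxtimes> B \<boxtimes> B\<^esub> tensor B (B \<boxtimes> B) \<one> (F (n - i)))" for n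
  proof -
    note \<alpha> = algebra_hom_simps[OF BBB.associator_hom]
    let ?e = "divided_power (B \<boxtimes> B \<boxtimes> B) q"
    have left_w: "associator B B B (tensor_map (B \<boxtimes> B) B (comult B) id w) = \<xi> \<oplus>\<^bsub>B \<boxtimes> B \<boxtimes> B\<^esub> \<eta>"
      by (simp add: gens_closed \<Delta>id.tensor_map_tensor \<Delta>_d1 BBB.L.tensor_simps \<alpha>
          BBB.associator_tensor)
    have right_w: "tensor_map B (B \<boxtimes> B) id (comult B) w = \<xi> \<oplus>\<^bsub>B \<boxtimes> B \<boxtimes> B\<^esub> \<zeta>"
      by (simp add: gens_closed id\<Delta>.tensor_map_tensor \<Delta>_d2 BBB.R.tensor_simps BBB.R.T.M.a_comm)
    have 1: "associator B B B (tensor_map (B \<boxtimes> B) B (comult B) id (F i)) =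
        ?e i (\<xi> \<oplus>\<^bsub>B \<boxtimes> B \<boxtimes> B\<^esub> \<eta>)" for i
      unfolding F_def by (simp add: dp[OF left_\<Delta> BBB_algebra] left_w)
    have 2: "associator B B B (tensor (B \<boxtimes> B) B (F i) \<one>) = ?e i \<zeta>" for i
      unfolding F_def
      by (subst dp[OF algebra_hom_comp[OF BBB.L.algebra_hom_left BBB.associator_hom] BBB_algebra])
        (simp add: BBB.associator_tensor gens_closed)
    have 3: "tensor_map B (B \<boxtimes> B) id (comult B) (F i) = ?e i (\<xi> \<oplus>\<^bsub>B \<boxtimes> B \<boxtimes> B\<^esub> \<zeta>)" for i
      unfolding F_def by (simp add: dp[OF id\<Delta>.tensor_map_hom BBB_algebra] right_w)
    have 4: "tensor B (B \<boxtimes> B) \<one> (F i) = ?e i \<eta>" for i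
      unfolding F_def by (rule dp[OF BBB.R.algebra_hom_right BBB_algebra])
    have closed: "tensor_map (B \<boxtimes> B) B (comult B) id (F i) \<in> carrier ((B \<boxtimes> B) \<boxtimes> B)"
      "tensor (B \<boxtimes> B) B (F i) \<one> \<in> carrier ((B \<boxtimes> B) \<boxtimes> B)" for i
      using F by (auto simp: algebra_hom_simps[OF \<Delta>id.tensor_map_hom])
    have "associator B B B
        (\<Oplus>\<^bsub>(B \<boxtimes> B) \<boxtimes> B\<^esub>i\<in>{..n}. tensor_map (B \<boxtimes> B) B (comult B) id (F i)
          \<otimes>\<^bsub>(B \<boxtimes> B) \<boxtimes> B\<^esub> tensor (B \<boxtimes> B) B (F (n - i)) \<one>) =
      (\<Oplus>\<^bsub>B \<boxtimes> B \<boxtimes> B\<^esub>i\<in>{..n}. ?e i (\<xi> \<oplus>\<^bsub>B \<boxtimes> B \<boxtimes> B\<^esub> \<eta>) \<otimes>\<^bsub>B \<boxtimes> B \<boxtimes> B\<^esub> ?e (n - i) \<zeta>)"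
      \<comment> \<open>The associator is linear and multiplicative, so it passes through the sum
        and the products, and the left side moves into
        \<open>B \<boxtimes> B \<boxtimes> B\<close>.\<close>
      using closed
      by (subst linear_map_finsum[OF algebra_hom_linear[OF BBB.associator_hom]
            BBB.L.T.module_axioms BBB.R.T.module_axioms]) (auto simp: \<alpha> 1 2)
    also have "\<dots> = (\<Oplus>\<^bsub>B \<boxtimes> B \<boxtimes> B\<^esub>i\<in>{..n}.
        ?e i (\<xi> \<oplus>\<^bsub>B \<boxtimes> B \<boxtimes> B\<^esub> \<zeta>) \<otimes>\<^bsub>B \<boxtimes> B \<boxtimes> B\<^esub> ?e (n - i) \<eta>)"
      by (rule T.divided_power_exchange) (simp_all add: gens_closed \<xi>_\<eta>_\<zeta>_relations \<xi>_\<eta>_null \<xi>_\<zeta>_null)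
    finally show ?thesis
      by (simp add: 3 4)
  qed
  moreover have "F 0 = tensor B B \<one> \<one>"
    by (simp add: F_def BBB.L.A.divided_power_0 BBB.AB.one_eq)
  ultimately show ?thesis
    unfolding universal_deformation_formula_def F_eq
    using F bialgebra by (auto simp: power_series_def fun_eq_iff)
qed

end

section \<open>Free algebras\<close>

lemma scale_conv_mult:
  fixes p :: "'k::monoid_add \<Rightarrow>\<^sub>0 complex"
  shows "scale c p = Poly_Mapping.single 0 c * p"
  by (simp add: scale_def mult_map_scale_conv_mult)

text \<open>Scaling by c is multiplication by c at the key 0, the neutral element of the monoid of
  keys, and this element is central.\<close>

lemma mult_scale:
  fixes p r :: "'k::monoid_add \<Rightarrow>\<^sub>0 complex"
  shows "scale c p * r = scale c (p * r)" "p * scale c r = scale c (p * r)"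
proof -
  have comm: "p * Poly_Mapping.single 0 c = Poly_Mapping.single 0 c * p"
    using subset_UNIV
    by (induction p rule: poly_mapping_span_induct)
      (simp_all add: distrib_left distrib_right mult_single mult.commute)
  show "scale c p * r = scale c (p * r)"
    by (simp add: scale_conv_mult mult.assoc)
  show "p * scale c r = scale c (p * r)"
    by (simp add: scale_conv_mult mult.assoc[symmetric] comm)
qed

lemma free_algebra_simps [simp]:
  "carrier free_algebra = UNIV" "\<one>\<^bsub>free_algebra\<^esub> = 1" "\<zero>\<^bsub>free_algebra\<^esub> = 0"
  "x \<otimes>\<^bsub>free_algebra\<^esub> y = x * y" "x \<oplus>\<^bsub>free_algebra\<^esub> y = x + y" "c \<odot>\<^bsub>free_algebra\<^esub> x = scale c x"
  by (simp_all add: free_algebra_def)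

lemma complex_algebra_free_algebra: "complex_algebra free_algebra"
proof (rule complex_algebraI)
  show "module complex_field free_algebra"
    by (rule module_cong[OF module_free_module[of UNIV]]) (auto simp: free_algebra_def free_module_def)
qed (simp_all add: mult.assoc distrib_left distrib_right mult_scale)

lemma single_Word: "Poly_Mapping.single (Word (g # gs)) 1 = letter g * Poly_Mapping.single (Word gs) 1"
  by (simp add: letter_def mult_single plus_word_def)

lemma single_Word_Nil: "Poly_Mapping.single (Word []) 1 = 1"
  by (metis single_one zero_word_def)

lemma generates_free_algebra: "generates free_algebra (range letter)"
proof -
  have "p \<in> K"
    if K: "range letter \<subseteq> K" "1 \<in> K" "\<forall>x\<in>K. \<forall>y\<in>K. x + y \<in> K" "\<forall>c. \<forall>x\<in>K. scale c x \<in> K"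
      "\<forall>x\<in>K. \<forall>y\<in>K. x * y \<in> K" for K and p :: "'g word \<Rightarrow>\<^sub>0 complex"
  proof -
    have word: "Poly_Mapping.single (Word gs) 1 \<in> K" for gs
    proof (induction gs)
      case (Cons a gs)
      have "letter a \<in> K"
        using K(1) by blast
      with Cons K(5) show ?case
        by (simp add: single_Word)
    qed (use K(2) in \<open>simp add: single_Word_Nil\<close>)
    show ?thesis
      using subset_UNIV
    proof (induction p rule: poly_mapping_span_induct)
      case zero
      have "scale 0 1 \<in> K"
        using K by blast
      moreover have "scale 0 1 = (0 :: 'g word \<Rightarrow>\<^sub>0 complex)"
        by (rule poly_mapping_eqI) simp
      ultimately show ?case
        by simp
    next
      case (single k c)
      have "scale c (Poly_Mapping.single (Word (letters k)) 1) \<in> K"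
        using K word by blast
      then show ?case
        by (simp add: scale_single)
    qed (use K in blast)
  qed
  then show ?thesis
    by (auto simp: generates_def)
qed

context
  fixes A :: "(complex, 'a, 'm) module_scheme" and f :: "'g \<Rightarrow> 'a"
  assumes A: "complex_algebra A" and f: "\<And>g. f g \<in> carrier A"
begin

interpretation A: complex_algebra A
  by (rule A)

text \<open>The monoid homomorphism from words to the multiplicative monoid of A;
  \<open>free_eval\<close> is its linear extension.\<close>

definition word_eval :: "'g word \<Rightarrow> 'a" where
  "word_eval v = foldr (\<lambda>g x. f g \<otimes>\<^bsub>A\<^esub> x) (letters v) \<one>\<^bsub>A\<^esub>"

lemma word_eval_closed: "word_eval v \<in> carrier A"
proof -
  have "foldr (\<lambda>g x. f g \<otimes>\<^bsub>A\<^esub> x) gs \<one>\<^bsub>A\<^esub> \<in> carrier A" for gs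
    using f by (induction gs) auto
  then show ?thesis
    by (simp add: word_eval_def)
qed

lemma word_eval_plus: "word_eval (u + v) = word_eval u \<otimes>\<^bsub>A\<^esub> word_eval v"
proof -
  have closed: "foldr (\<lambda>g x. f g \<otimes>\<^bsub>A\<^esub> x) gs \<one>\<^bsub>A\<^esub> \<in> carrier A" for gs
    using f by (induction gs) auto
  have "foldr (\<lambda>g x. f g \<otimes>\<^bsub>A\<^esub> x) (gs @ hs) \<one>\<^bsub>A\<^esub> =
      foldr (\<lambda>g x. f g \<otimes>\<^bsub>A\<^esub> x) gs \<one>\<^bsub>A\<^esub> \<otimes>\<^bsub>A\<^esub> foldr (\<lambda>g x. f g \<otimes>\<^bsub>A\<^esub> x) hs \<one>\<^bsub>A\<^esub>" for gs hs
    using f closed by (induction gs) (simp_all add: A.m_assoc)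
  then show ?thesis
    by (simp add: word_eval_def plus_word_def)
qed

lemma free_eval_eq: "free_eval A f = linear_ext A word_eval"
  by (simp add: free_eval_def word_eval_def[abs_def])

lemma free_eval_linear: "linear_map free_algebra A (free_eval A f)"
  using linear_map_linear_ext[of A UNIV word_eval, OF A.module_axioms word_eval_closed]
  by (simp add: free_eval_eq linear_map_def)

lemma free_eval_single: "free_eval A f (Poly_Mapping.single v c) = c \<odot>\<^bsub>A\<^esub> word_eval v"
  unfolding free_eval_eq by (rule linear_ext_single[of A UNIV]) (auto simp: A.module_axioms word_eval_closed)

lemma free_eval_letter: "free_eval A f (letter g) = f g"
  using f by (simp add: letter_def free_eval_single word_eval_def A.one_smult)

lemma free_eval_hom: "free_eval A f \<in> algebra_hom free_algebra A"
proof (rule algebra_homI[OF free_eval_linear])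
  note lin = linear_map_simps[OF free_eval_linear, simplified]
  have eval_0: "free_eval A f 0 = \<zero>\<^bsub>A\<^esub>"
    using linear_map_zero[OF free_eval_linear
        complex_algebra.axioms(1)[OF complex_algebra_free_algebra] A.module_axioms] by simp
  have half: "free_eval A f (Poly_Mapping.single v c * r) =
      free_eval A f (Poly_Mapping.single v c) \<otimes>\<^bsub>A\<^esub> free_eval A f r" for v c r
    using subset_UNIV
  proof (induction r rule: poly_mapping_span_induct)
    case zero
    then show ?case
      using lin(1) by (simp add: eval_0)
  next
    case (single k d)
    then show ?case
      by (simp add: mult_single free_eval_single word_eval_plus word_eval_closed A.smult_mult_left
          A.smult_mult_right A.smult_smult mult.commute)
  qed (simp add: distrib_left lin A.r_distr)
  show "free_eval A f (p \<otimes>\<^bsub>free_algebra\<^esub> r) = free_eval A f p \<otimes>\<^bsub>A\<^esub> free_eval A f r" for p r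
    using subset_UNIV[of "Poly_Mapping.keys p"]
  proof (induction p rule: poly_mapping_span_induct)
    case zero
    then show ?case
      using lin(1) by (simp add: eval_0)
  qed (simp_all add: half distrib_right lin A.l_distr)
  show "free_eval A f \<one>\<^bsub>free_algebra\<^esub> = \<one>\<^bsub>A\<^esub>"
    by (simp add: single_Word_Nil[symmetric] free_eval_single word_eval_def A.one_smult)
qed

end

text \<open>Translates between relators and equations in both directions: for relations that hold in
  H, and for homomorphisms that are to factor through H.\<close>

lemma free_algebra_hom_diff_eq_0:
  assumes "h \<in> algebra_hom free_algebra A" "complex_algebra A"
  shows "h (x - y) = \<zero>\<^bsub>A\<^esub> \<longleftrightarrow> h x = h y"
proof -
  interpret A: complex_algebra A by fact
  note lin = algebra_hom_simps[OF assms(1), simplified]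
  have "h x = h (x - y) \<oplus>\<^bsub>A\<^esub> h y"
    using lin(4)[of "x - y" y] by simp
  then show ?thesis
    using A.M.add.l_cancel_one'[of "h y" "h (x - y)"] lin(3) A.M.add.r_cancel_one'[of "h y" "h (x - y)"]
    by auto
qed

section \<open>The algebra \<open>H\<close>\<close>

text \<open>The construction reads only the carriers and operations. Records with extra bialgebra
  fields thus have literally the same tensor product as their underlying algebras.\<close>

lemma tensor_cong:
  fixes A :: "(complex, 'a, 'm) module_scheme" and A' :: "(complex, 'a, 'm2) module_scheme"
    and B :: "(complex, 'b, 'n) module_scheme" and B' :: "(complex, 'b, 'n2) module_scheme"
  assumes "carrier A' = carrier A" "add A' = add A" "module.smult A' = module.smult A"
    "monoid.mult A' = monoid.mult A" "one A' = one A"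
    "carrier B' = carrier B" "add B' = add B" "module.smult B' = module.smult B"
    "monoid.mult B' = monoid.mult B" "one B' = one B"
  shows "tensor A' B' = tensor A B" "A' \<boxtimes> B' = A \<boxtimes> B"
proof -
  have null: "tensor_null A' B' = tensor_null A B"
    by (simp add: tensor_null_def bilinear_relators_def assms)
  show tensor: "tensor A' B' = tensor A B"
    by (intro ext) (simp add: tensor_def null assms)
  have "tensor_module A' B' = tensor_module A B"
    by (simp add: tensor_module_def null assms)
  then show "A' \<boxtimes> B' = A \<boxtimes> B"
    by (simp add: tensor_algebra_def tensor assms)
qed

lemma H_fields [simp]:
  "carrier (H q) = carrier (H_algebra q)" "add (H q) = add (H_algebra q)"
  "ring.zero (H q) = ring.zero (H_algebra q)" "module.smult (H q) = module.smult (H_algebra q)"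
  "monoid.mult (H q) = monoid.mult (H_algebra q)" "one (H q) = one (H_algebra q)"
  by (simp_all add: H_def Let_def)

lemma H_tensor: "tensor (H q) (H q) = tensor (H_algebra q) (H_algebra q)"
  "H q \<boxtimes> H q = H_algebra q \<boxtimes> H_algebra q"
  by (rule tensor_cong; simp)+

lemma algebra_hom_H: "algebra_hom (H q) C = algebra_hom (H_algebra q) C"
  by (simp add: algebra_hom_def ring_hom_def)

lemma UNIV_gen: "UNIV = {D1, D2, Sigma, Sigma_inv}"
  using gen.exhaust by auto

section \<open>Relations and structure maps of H\<close>

context
  fixes q :: complex
begin

interpretation P: presented_algebra free_algebra "H_relators q"
  by (intro presented_algebra.intro presented_algebra_axioms.intro complex_algebra_free_algebra) simp

interpretation A: complex_algebra "H_algebra q"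
  using P.complex_algebra_quotient by (simp add: H_algebra_def H_ideal_def)

lemma complex_algebra_H: "complex_algebra (H q)"
  by (rule complex_algebra_cong[OF A.complex_algebra_axioms]) simp_all

interpretation T: tensor_algebras "H_algebra q" "H_algebra q"
  by (intro tensor_algebrasI A.complex_algebra_axioms)

interpretation TT: complex_algebra "H_algebra q \<boxtimes> H_algebra q"
  by (rule T.complex_algebra_tensor)

private abbreviation \<pi> where "\<pi> x \<equiv> H_ideal q +>\<^bsub>free_algebra\<^esub> x"

lemma \<pi>_hom: "\<pi> \<in> algebra_hom free_algebra (H_algebra q)"
  using P.algebra_hom_coset by (simp add: H_algebra_def H_ideal_def)

lemma \<pi>_surj: "\<pi> ` carrier free_algebra = carrier (H_algebra q)"
  using P.quotient_carrier by (simp add: H_algebra_def H_ideal_def)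

lemma H_gen_closed [simp]: "H_gen q g \<in> carrier (H_algebra q)"
  unfolding H_gen_def by (rule linear_map_closed[OF algebra_hom_linear[OF \<pi>_hom]]) simp

lemma H_generates: "generates (H q) {H_gen q D1, H_gen q D2, H_gen q Sigma, H_gen q Sigma_inv}"
proof -
  have "generates (H_algebra q) (\<pi> ` range letter)"
    by (rule generates_image[OF generates_free_algebra _ complex_algebra_free_algebra \<pi>_hom \<pi>_surj])
      simp
  then show ?thesis
    by (simp add: UNIV_gen H_gen_def generates_cong[of "H q" "H_algebra q"])
qed

lemma \<pi>_relator: "r \<in> H_relators q \<Longrightarrow> \<pi> r = \<zero>\<^bsub>H_algebra q\<^esub>"
  using P.relator_coset by (simp add: H_algebra_def H_ideal_def)

lemma H_relations:
  "H_gen q D1 \<otimes>\<^bsub>H_algebra q\<^esub> H_gen q D2 = H_gen q D2 \<otimes>\<^bsub>H_algebra q\<^esub> H_gen q D1"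
  "H_gen q D1 \<otimes>\<^bsub>H_algebra q\<^esub> H_gen q Sigma =
     q \<odot>\<^bsub>H_algebra q\<^esub> (H_gen q Sigma \<otimes>\<^bsub>H_algebra q\<^esub> H_gen q D1)"
  "H_gen q D2 \<otimes>\<^bsub>H_algebra q\<^esub> H_gen q Sigma =
     q \<odot>\<^bsub>H_algebra q\<^esub> (H_gen q Sigma \<otimes>\<^bsub>H_algebra q\<^esub> H_gen q D2)"
  "H_gen q Sigma \<otimes>\<^bsub>H_algebra q\<^esub> H_gen q Sigma_inv = \<one>\<^bsub>H_algebra q\<^esub>"
  "H_gen q Sigma_inv \<otimes>\<^bsub>H_algebra q\<^esub> H_gen q Sigma = \<one>\<^bsub>H_algebra q\<^esub>"
proof -
  have eq: "\<pi> x = \<pi> y" if "x - y \<in> H_relators q" for x y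
    using \<pi>_relator[OF that] free_algebra_hom_diff_eq_0[OF \<pi>_hom A.complex_algebra_axioms] by simp
  note \<pi>_simps = algebra_hom_simps[OF \<pi>_hom, simplified, folded H_gen_def]
  show "H_gen q D1 \<otimes>\<^bsub>H_algebra q\<^esub> H_gen q D2 = H_gen q D2 \<otimes>\<^bsub>H_algebra q\<^esub> H_gen q D1"
    using eq[of "letter D1 * letter D2" "letter D2 * letter D1"]
    by (simp add: H_relators_def \<pi>_simps H_gen_def)
  show "H_gen q D1 \<otimes>\<^bsub>H_algebra q\<^esub> H_gen q Sigma =
     q \<odot>\<^bsub>H_algebra q\<^esub> (H_gen q Sigma \<otimes>\<^bsub>H_algebra q\<^esub> H_gen q D1)"
    using eq[of "scale q (letter Sigma * letter D1)" "letter D1 * letter Sigma"]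
    by (simp add: H_relators_def \<pi>_simps H_gen_def)
  show "H_gen q D2 \<otimes>\<^bsub>H_algebra q\<^esub> H_gen q Sigma =
     q \<odot>\<^bsub>H_algebra q\<^esub> (H_gen q Sigma \<otimes>\<^bsub>H_algebra q\<^esub> H_gen q D2)"
    using eq[of "scale q (letter Sigma * letter D2)" "letter D2 * letter Sigma"]
    by (simp add: H_relators_def \<pi>_simps H_gen_def)
  show "H_gen q Sigma \<otimes>\<^bsub>H_algebra q\<^esub> H_gen q Sigma_inv = \<one>\<^bsub>H_algebra q\<^esub>"
    using eq[of "letter Sigma * letter Sigma_inv" 1] by (simp add: H_relators_def \<pi>_simps H_gen_def)
  show "H_gen q Sigma_inv \<otimes>\<^bsub>H_algebra q\<^esub> H_gen q Sigma = \<one>\<^bsub>H_algebra q\<^esub>"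
    using eq[of "letter Sigma_inv * letter Sigma" 1] by (simp add: H_relators_def \<pi>_simps H_gen_def)
qed

lemma
  assumes B: "complex_algebra B" and f: "\<And>g. f g \<in> carrier B"
    and rel: "f D1 \<otimes>\<^bsub>B\<^esub> f D2 = f D2 \<otimes>\<^bsub>B\<^esub> f D1"
      "f D1 \<otimes>\<^bsub>B\<^esub> f Sigma = q \<odot>\<^bsub>B\<^esub> (f Sigma \<otimes>\<^bsub>B\<^esub> f D1)"
      "f D2 \<otimes>\<^bsub>B\<^esub> f Sigma = q \<odot>\<^bsub>B\<^esub> (f Sigma \<otimes>\<^bsub>B\<^esub> f D2)"
      "f Sigma \<otimes>\<^bsub>B\<^esub> f Sigma_inv = \<one>\<^bsub>B\<^esub>" "f Sigma_inv \<otimes>\<^bsub>B\<^esub> f Sigma = \<one>\<^bsub>B\<^esub>"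
  shows H_lift_hom: "induced (free_eval B f) \<in> algebra_hom (H q) B"
    and H_lift_gen: "induced (free_eval B f) (H_gen q g) = f g"
proof -
  note E = free_eval_hom[OF B f]
  note zero = free_algebra_hom_diff_eq_0[OF E B]
  have null: "free_eval B f r = \<zero>\<^bsub>B\<^esub>" if "r \<in> H_relators q" for r
    using that by (auto simp: H_relators_def zero algebra_hom_simps[OF E, simplified]
        free_eval_letter[OF B f] rel)
  show "induced (free_eval B f) \<in> algebra_hom (H q) B"
    using P.algebra_hom_induced[OF B E null] by (simp add: algebra_hom_H H_algebra_def H_ideal_def)
  show "induced (free_eval B f) (H_gen q g) = f g"
    using P.induced_relators[OF B E null] by (simp add: H_gen_def H_ideal_def free_eval_letter[OF B f])
qed

lemma H_comult_gen_closed: "H_comult_gen q g \<in> carrier (H_algebra q \<boxtimes> H_algebra q)"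
  by (cases g) (simp_all add: H_comult_gen_def Let_def)

lemma comult_H: "comult (H q) = induced (free_eval (H_algebra q \<boxtimes> H_algebra q) (H_comult_gen q))"
  by (simp add: H_def Let_def)

lemma counit_H: "counit (H q) = induced (free_eval scalars H_counit_gen)"
  by (simp add: H_def Let_def)

text \<open>The prescribed values must satisfy the relations of H. For D1 D2 = D2 D1 the critical
  mixed terms are D1 \<sigma> \<otimes> \<sigma> D2 and \<sigma> D1 \<otimes> D2 \<sigma>, both
  equal to q (\<sigma> D1 \<otimes> \<sigma> D2).\<close>

lemma H_comult: "comult (H q) \<in> algebra_hom (H q) (H q \<boxtimes> H q)"
  "comult (H q) (H_gen q g) = H_comult_gen q g"
proof -
  note simps = H_comult_gen_def Let_def T.tensor_mult TT.l_distr TT.r_distr H_relations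
    T.tensor_simps T.T.smult_r_distr T.T.M.a_ac
  note lift = T.complex_algebra_tensor H_comult_gen_closed
  show "comult (H q) \<in> algebra_hom (H q) (H q \<boxtimes> H q)"
    unfolding comult_H H_tensor by (rule H_lift_hom[OF lift]) (simp_all add: simps T.one_eq)
  show "comult (H q) (H_gen q g) = H_comult_gen q g"
    unfolding comult_H by (rule H_lift_gen[OF lift]) (simp_all add: simps T.one_eq)
qed

lemma H_counit: "counit (H q) \<in> algebra_hom (H q) scalars"
  "counit (H q) (H_gen q g) = H_counit_gen g"
  unfolding counit_H
  by (rule H_lift_hom[OF complex_algebra_scalars] H_lift_gen[OF complex_algebra_scalars];
      simp add: H_counit_gen_def)+

lemma skew_bialgebra_H:
  assumes "q = 1 \<or> \<not> root_of_unity q"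
  shows "skew_bialgebra (H q) q (H_gen q D1) (H_gen q D2) (H_gen q Sigma) (H_gen q Sigma_inv)"
proof -
  have "\<not> primitive_root_of_unity l q" if "l \<ge> 2" for l
  proof
    assume "primitive_root_of_unity l q"
    then have l: "l > 0" "q ^ l = 1" "0 < (1::nat) \<and> 1 < l \<longrightarrow> q ^ 1 \<noteq> 1"
      unfolding primitive_root_of_unity_def by blast+
    then have "root_of_unity q"
      unfolding root_of_unity_def by blast
    moreover have "q \<noteq> 1"
      using l(3) that by simp
    ultimately show False
      using assms by blast
  qed
  \<comment> \<open>Every n is an exponent, so the nilpotency conditions of
    \<open>skew_bialgebra\<close> hold vacuously.\<close>
  then have "q_exponent q n" for n
    by (simp add: q_exponent_def)
  then show ?thesis
    by (intro skew_bialgebra.intro skew_bialgebra_axioms.intro complex_algebra_H H_generates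
        H_comult(1) H_counit(1))
      (simp_all add: H_relations H_comult(2) H_counit(2) H_tensor H_comult_gen_def H_counit_gen_def
        Let_def)
qed

end

section \<open>The quotient of \<open>H\<close> at a root of unity\<close>

context
  fixes q :: complex and l :: nat
  assumes l: "l \<ge> 2" and root: "primitive_root_of_unity l q"
begin

interpretation P: presented_algebra "H q" "{H_gen q D1 [^]\<^bsub>H q\<^esub> l, H_gen q D2 [^]\<^bsub>H q\<^esub> l}"
proof -
  interpret complex_algebra "H q" by (rule complex_algebra_H)
  show "presented_algebra (H q) {H_gen q D1 [^]\<^bsub>H q\<^esub> l, H_gen q D2 [^]\<^bsub>H q\<^esub> l}"
    by (intro presented_algebra.intro presented_algebra_axioms.intro complex_algebra_axioms)
      (use nat_pow_closed[of _ l] H_gen_closed in auto)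
qed

private abbreviation Q where "Q \<equiv> quotient (H q) (D_ideal q l)"

interpretation Q: complex_algebra Q
  using P.complex_algebra_quotient by (simp add: D_ideal_def)

interpretation HH: tensor_algebras "H q" "H q"
  by (intro tensor_algebrasI complex_algebra_H)

interpretation QQ: tensor_algebras Q Q
  by (intro tensor_algebrasI Q.complex_algebra_axioms)

interpretation T: complex_algebra "Q \<boxtimes> Q"
  by (rule QQ.complex_algebra_tensor)

private abbreviation \<rho> where "\<rho> x \<equiv> D_ideal q l +>\<^bsub>H q\<^esub> x"

lemma \<rho>_hom: "\<rho> \<in> algebra_hom (H q) Q"
  using P.algebra_hom_coset by (simp add: D_ideal_def)

interpretation \<rho>\<rho>: tensor_homs "H q" "H q" Q Q \<rho> \<rho>
  by (intro tensor_homsI complex_algebra_H Q.complex_algebra_axioms \<rho>_hom)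

private abbreviation g where "g x \<equiv> H_mod_gen q l x"

lemma H_mod_gen_eq: "g x = \<rho> (H_gen q x)"
  by (simp add: H_mod_gen_def)

lemma g_closed [simp]: "g x \<in> carrier Q"
  unfolding H_mod_gen_eq by (rule linear_map_closed[OF algebra_hom_linear[OF \<rho>_hom]]) simp

lemma H_mod_relations:
  "g D1 \<otimes>\<^bsub>Q\<^esub> g D2 = g D2 \<otimes>\<^bsub>Q\<^esub> g D1"
  "g D1 \<otimes>\<^bsub>Q\<^esub> g Sigma = q \<odot>\<^bsub>Q\<^esub> (g Sigma \<otimes>\<^bsub>Q\<^esub> g D1)"
  "g D2 \<otimes>\<^bsub>Q\<^esub> g Sigma = q \<odot>\<^bsub>Q\<^esub> (g Sigma \<otimes>\<^bsub>Q\<^esub> g D2)"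
proof -
  have H: "H_gen q x \<otimes>\<^bsub>H q\<^esub> H_gen q y \<in> carrier (H q)" for x y
    by (rule P.m_closed) simp_all
  show "g D1 \<otimes>\<^bsub>Q\<^esub> g D2 = g D2 \<otimes>\<^bsub>Q\<^esub> g D1"
    "g D1 \<otimes>\<^bsub>Q\<^esub> g Sigma = q \<odot>\<^bsub>Q\<^esub> (g Sigma \<otimes>\<^bsub>Q\<^esub> g D1)"
    "g D2 \<otimes>\<^bsub>Q\<^esub> g Sigma = q \<odot>\<^bsub>Q\<^esub> (g Sigma \<otimes>\<^bsub>Q\<^esub> g D2)"
    using H unfolding H_mod_gen_eq
    by (simp_all add: algebra_hom_mult[OF \<rho>_hom, symmetric]
        linear_map_smult[OF algebra_hom_linear[OF \<rho>_hom], symmetric] H_relations)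
qed

lemma H_mod_pow_l: "g D1 [^]\<^bsub>Q\<^esub> l = \<zero>\<^bsub>Q\<^esub>" "g D2 [^]\<^bsub>Q\<^esub> l = \<zero>\<^bsub>Q\<^esub>"
proof -
  have "g x [^]\<^bsub>Q\<^esub> l = \<rho> (H_gen q x [^]\<^bsub>H q\<^esub> l)" for x
    unfolding H_mod_gen_eq
    by (rule algebra_hom_pow[OF \<rho>_hom P.ring_axioms Q.ring_axioms, symmetric]) simp
  then show "g D1 [^]\<^bsub>Q\<^esub> l = \<zero>\<^bsub>Q\<^esub>" "g D2 [^]\<^bsub>Q\<^esub> l = \<zero>\<^bsub>Q\<^esub>"
    using P.relator_coset by (simp_all add: D_ideal_def)
qed

lemma H_mod_fields [simp]:
  "carrier (H_mod q l) = carrier Q" "add (H_mod q l) = add Q"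
  "ring.zero (H_mod q l) = ring.zero Q" "module.smult (H_mod q l) = module.smult Q"
  "monoid.mult (H_mod q l) = monoid.mult Q" "one (H_mod q l) = one Q"
  by (simp_all add: H_mod_def hopf_quotient_def Let_def)

lemma complex_algebra_H_mod: "complex_algebra (H_mod q l)"
  by (rule complex_algebra_cong[OF Q.complex_algebra_axioms]) simp_all

lemma H_mod_tensor: "tensor (H_mod q l) (H_mod q l) = tensor Q Q"
  "H_mod q l \<boxtimes> H_mod q l = Q \<boxtimes> Q"
  by (rule tensor_cong; simp)+

lemma algebra_hom_H_mod: "algebra_hom (H_mod q l) C = algebra_hom Q C"
  by (simp add: algebra_hom_def ring_hom_def)

lemma H_mod_generates: "generates (H_mod q l) {g D1, g D2, g Sigma, g Sigma_inv}"
proof -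
  have "generates Q (\<rho> ` {H_gen q D1, H_gen q D2, H_gen q Sigma, H_gen q Sigma_inv})"
    by (rule generates_image[OF H_generates _ complex_algebra_H \<rho>_hom])
      (use P.quotient_carrier in \<open>auto simp: D_ideal_def\<close>)
  then show ?thesis
    by (simp add: H_mod_gen_eq generates_cong[of "H_mod q l" Q])
qed

lemma comult_H_mod: "comult (H_mod q l) = induced (\<lambda>x. tensor_map Q Q \<rho> \<rho> (comult (H q) x))"
  by (simp add: H_mod_def hopf_quotient_def Let_def)

lemma counit_H_mod: "counit (H_mod q l) = induced (counit (H q))"
  by (simp add: H_mod_def hopf_quotient_def Let_def)

lemmas \<rho>\<rho>_comult = algebra_hom_comp[OF H_comult(1) \<rho>\<rho>.tensor_map_hom]

lemma \<rho>\<rho>_comult_gen: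
  "tensor_map Q Q \<rho> \<rho> (comult (H q) (H_gen q D1)) =
     tensor Q Q (g D1) (g Sigma) \<oplus>\<^bsub>Q \<boxtimes> Q\<^esub> tensor Q Q \<one>\<^bsub>Q\<^esub> (g D1)"
  "tensor_map Q Q \<rho> \<rho> (comult (H q) (H_gen q D2)) =
     tensor Q Q (g D2) \<one>\<^bsub>Q\<^esub> \<oplus>\<^bsub>Q \<boxtimes> Q\<^esub> tensor Q Q (g Sigma) (g D2)"
  "tensor_map Q Q \<rho> \<rho> (comult (H q) (H_gen q Sigma)) = tensor Q Q (g Sigma) (g Sigma)"
  "tensor_map Q Q \<rho> \<rho> (comult (H q) (H_gen q Sigma_inv)) = tensor Q Q (g Sigma_inv) (g Sigma_inv)"
proof -
  have one: "\<one>\<^bsub>H_algebra q\<^esub> \<in> carrier (H_algebra q)"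
    using P.one_closed by simp
  have [simp]: "tensor (H_algebra q) (H_algebra q) x y \<in> carrier (H_algebra q \<boxtimes> H_algebra q)"
    if "x \<in> carrier (H_algebra q)" "y \<in> carrier (H_algebra q)" for x y
    using HH.tensor_closed that by (simp add: H_tensor)
  note simps = one H_comult(2) H_comult_gen_def Let_def H_mod_gen_eq
    linear_map_add[OF algebra_hom_linear[OF \<rho>\<rho>.tensor_map_hom], unfolded H_tensor]
    \<rho>\<rho>.tensor_map_tensor[unfolded H_tensor] algebra_hom_one[OF \<rho>_hom, simplified]
  show "tensor_map Q Q \<rho> \<rho> (comult (H q) (H_gen q D1)) =
     tensor Q Q (g D1) (g Sigma) \<oplus>\<^bsub>Q \<boxtimes> Q\<^esub> tensor Q Q \<one>\<^bsub>Q\<^esub> (g D1)"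
    "tensor_map Q Q \<rho> \<rho> (comult (H q) (H_gen q D2)) =
     tensor Q Q (g D2) \<one>\<^bsub>Q\<^esub> \<oplus>\<^bsub>Q \<boxtimes> Q\<^esub> tensor Q Q (g Sigma) (g D2)"
    "tensor_map Q Q \<rho> \<rho> (comult (H q) (H_gen q Sigma)) = tensor Q Q (g Sigma) (g Sigma)"
    "tensor_map Q Q \<rho> \<rho> (comult (H q) (H_gen q Sigma_inv)) = tensor Q Q (g Sigma_inv) (g Sigma_inv)"
    by (simp_all add: simps)
qed

text \<open>The two summands of \<Delta>(D_i) q-commute and have vanishing l-th powers in the
  quotient, so \<open>nilpotent_add\<close> applies to their sum.\<close>

lemma \<rho>\<rho>_comult_null:
  assumes "r \<in> {H_gen q D1 [^]\<^bsub>H q\<^esub> l, H_gen q D2 [^]\<^bsub>H q\<^esub> l}"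
  shows "tensor_map Q Q \<rho> \<rho> (comult (H q) r) = \<zero>\<^bsub>Q \<boxtimes> Q\<^esub>"
proof -
  note pow = algebra_hom_pow[OF \<rho>\<rho>_comult P.ring_axioms T.ring_axioms]
  note simps = QQ.tensor_mult H_mod_relations QQ.tensor_simps QQ.tensor_pow H_mod_pow_l
  have "(tensor Q Q (g D1) (g Sigma) \<oplus>\<^bsub>Q \<boxtimes> Q\<^esub> tensor Q Q \<one>\<^bsub>Q\<^esub> (g D1)) [^]\<^bsub>Q \<boxtimes> Q\<^esub> l = \<zero>\<^bsub>Q \<boxtimes> Q\<^esub>"
    by (rule T.nilpotent_add[OF _ _ _ root l]) (simp_all add: simps)
  moreover
  \<comment> \<open>The summands of \<Delta>(D2) are swapped: y x = q x y holds for x = \<sigma>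
    \<otimes> D2 and y = D2 \<otimes> 1.\<close>
  have "(tensor Q Q (g Sigma) (g D2) \<oplus>\<^bsub>Q \<boxtimes> Q\<^esub> tensor Q Q (g D2) \<one>\<^bsub>Q\<^esub>) [^]\<^bsub>Q \<boxtimes> Q\<^esub> l = \<zero>\<^bsub>Q \<boxtimes> Q\<^esub>"
    by (rule T.nilpotent_add[OF _ _ _ root l]) (simp_all add: simps)
  ultimately show ?thesis
    using assms by (auto simp: pow \<rho>\<rho>_comult_gen QQ.T.M.a_comm)
qed

lemma H_mod_comult: "comult (H_mod q l) \<in> algebra_hom (H_mod q l) (H_mod q l \<boxtimes> H_mod q l)"
  "comult (H_mod q l) (g x) = tensor_map Q Q \<rho> \<rho> (comult (H q) (H_gen q x))"
  using P.algebra_hom_induced[OF T.complex_algebra_axioms \<rho>\<rho>_comult \<rho>\<rho>_comult_null]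
    P.induced_relators[OF T.complex_algebra_axioms \<rho>\<rho>_comult \<rho>\<rho>_comult_null, of "H_gen q x"]
  by (simp_all add: comult_H_mod algebra_hom_H_mod H_mod_tensor D_ideal_def H_mod_gen_def)

lemma counit_null:
  assumes "r \<in> {H_gen q D1 [^]\<^bsub>H q\<^esub> l, H_gen q D2 [^]\<^bsub>H q\<^esub> l}"
  shows "counit (H q) r = \<zero>\<^bsub>scalars\<^esub>"
proof -
  interpret S: complex_algebra scalars by (rule complex_algebra_scalars)
  have "counit (H q) (H_gen q x [^]\<^bsub>H q\<^esub> l) = H_counit_gen x [^]\<^bsub>scalars\<^esub> l" for x
    by (subst algebra_hom_pow[OF H_counit(1) P.ring_axioms S.ring_axioms]) (simp_all add: H_counit(2))
  then show ?thesis
    using assms l S.nat_pow_zero[of l] by (auto simp: H_counit_gen_def)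
qed

lemma H_mod_counit: "counit (H_mod q l) \<in> algebra_hom (H_mod q l) scalars"
  "counit (H_mod q l) (g x) = H_counit_gen x"
  using P.algebra_hom_induced[OF complex_algebra_scalars H_counit(1) counit_null]
    P.induced_relators[OF complex_algebra_scalars H_counit(1) counit_null, of "H_gen q x"]
  by (simp_all add: counit_H_mod algebra_hom_H_mod D_ideal_def H_mod_gen_def H_counit(2))

lemma H_mod_pow:
  assumes "\<not> q_exponent q n"
  shows "g D1 [^]\<^bsub>H_mod q l\<^esub> n = \<zero>\<^bsub>Q\<^esub>" "g D2 [^]\<^bsub>H_mod q l\<^esub> n = \<zero>\<^bsub>Q\<^esub>"
proof -
  \<comment> \<open>A non-exponent n is at least l, so the vanishing l-th power splits off.\<close>
  have n: "n = l + (n - l)"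
    using assms q_exponent_primitive_root[OF root l] by simp
  have pow_eq: "x [^]\<^bsub>H_mod q l\<^esub> n = x [^]\<^bsub>Q\<^esub> n" for x
    by (simp add: nat_pow_def)
  have "g x [^]\<^bsub>H_mod q l\<^esub> n = g x [^]\<^bsub>Q\<^esub> l \<otimes>\<^bsub>Q\<^esub> g x [^]\<^bsub>Q\<^esub> (n - l)" for x
    unfolding pow_eq by (subst n) (simp add: Q.nat_pow_mult)
  then show "g D1 [^]\<^bsub>H_mod q l\<^esub> n = \<zero>\<^bsub>Q\<^esub>" "g D2 [^]\<^bsub>H_mod q l\<^esub> n = \<zero>\<^bsub>Q\<^esub>"
    by (simp_all add: H_mod_pow_l)
qed

lemma skew_bialgebra_H_mod: "skew_bialgebra (H_mod q l) q (g D1) (g D2) (g Sigma) (g Sigma_inv)"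
  by (intro skew_bialgebra.intro skew_bialgebra_axioms.intro complex_algebra_H_mod H_mod_generates
      H_mod_comult(1) H_mod_counit(1))
    (simp_all add: H_mod_relations H_mod_pow H_mod_comult(2) \<rho>\<rho>_comult_gen H_mod_counit(2)
      H_mod_tensor H_counit_gen_def)

end

theorem theorem3p3:
  fixes q :: complex
  assumes "q \<noteq> 0"
  shows "(q = 1 \<or> \<not> root_of_unity q \<longrightarrow>
            universal_deformation_formula (H q)
              (q_exp (H q \<boxtimes> H q) q
                (t_times (H q \<boxtimes> H q) (tensor (H q) (H q) (H_gen q D1) (H_gen q D2))))) \<and>
         (\<forall>l\<ge>2. primitive_root_of_unity l q \<longrightarrow>
            universal_deformation_formula (H_mod q l)
              (q_exp (H_mod q l \<boxtimes> H_mod q l) q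
                (t_times (H_mod q l \<boxtimes> H_mod q l)
                  (tensor (H_mod q l) (H_mod q l) (H_mod_gen q l D1) (H_mod_gen q l D2)))))"
  by (intro conjI impI allI)
    (rule skew_bialgebra.universal_deformation_formula_q_exp,
      (rule skew_bialgebra_H skew_bialgebra_H_mod; assumption))+

end
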